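(* Let $A$ be a finite-dimensional vector space over $K$, let $((A,[,]),N)$ and $((A^*,[,]_{A^*}),S^* )$ be two Nijenhuis left Alia algebras, where $S:A\to A$ is linear, and let $\Delta:A\to A\otimes A$ be the linear dual of $[,]_{A^*}$, i.e. $\langle a^*\otimes b^*,\Delta(x)\rangle=\langle[a^*,b^*]_{A^*},x\rangle$ for all $x\in A$, $a^*,b^*\in A^*$ (so $[,]_{A^*}=\Delta^*$). Then the following conditions are equivalent: (1) $((A,N),(A^*,S^* ),\mathcal L_A^*,\mathcal L_A^*-\mathcal R_A^*,\mathcal L_{A^*}^*,\mathcal L_{A^*}^*-\mathcal R_{A^*}^* )$ is a matched pair of the Nijenhuis left Alia algebras $((A,[,]),N)$ and $((A^*,[,]_{A^*}),S^* )$. (2) There is a Manin triple $((A\oplus A^*,[,]_{A\oplus A^*},N+S^*,\mathcal B),(A,N),(A^*,S^* ))$ of Nijenhuis left Alia algebras associated to $((A,[,]),N)$ and $((A^*,[,]_{A^*}),S^* )$. (3) $((A,[,],\Delta),N,S)$ is a Nijenhuis left Alia bialgebra.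
   Context: $K$ is a field of characteristic zero. A left Alia algebra is $(A,[,])$ with $[,]$ bilinear and $[[x,y],z]+[[y,z],x]+[[z,x],y]=[[y,x],z]+[[z,y],x]+[[x,z],y]$. A Nijenhuis left Alia algebra $((A,[,]),N)$ has in addition a linear map $N$ with $[N(x),N(y)]+N^2([x,y])=N([N(x),y]+[x,N(y)])$. A representation of $(A,[,])$ is $(V,\ell,r)$ with $\ell,r:A\to\mathrm{End}(V)$ linear and $\ell([x,y])-\ell([y,x])=r(x)(r(y)-\ell(y))-r(y)(r(x)-\ell(x))$. A representation of $((A,[,]),N)$ is $((V,\ell,r),\alpha)$ with $(V,\ell,r)$ a representation of $(A,[,])$ and $\alpha:V\to V$ linear such that $\ell(N(x))(\alpha(v))+\alpha^2(\ell(x)(v))=\alpha(\ell(N(x))(v))+\alpha(\ell(x)(\alpha(v)))$ and likewise with $r$ in place of $\ell$. $\mathcal L(x)y=[x,y]=\mathcal R(y)x$ (subscripts $A$, $A^*$ indicate the algebra). For $\rho:A\to\mathrm{End}(V)$, $\rho^*:A\to\mathrm{End}(V^* )$ is $\langle\rho^*(x)u^*,v\rangle=-\langle u^*,\rho(x)v\rangle$. For a linear map $S:A\to A$, $S^*:A^*\to A^*$ is the usual transpose (no sign). $A^{**}$ is identified with $A$. A matched pair of left Alia algebras $((A,[,]_A),(B,[,]_B),\ell_A,r_A,\ell_B,r_B)$: $(B,\ell_A,r_A)$ is a representation of $A$, $(A,\ell_B,r_B)$ is a representation of $B$, and for all $x,y\in A$, $a,b\in B$ $$r_B(a)([x,y]_A-[y,x]_A)=[(\ell_B-r_B)(a)(y),x]_A+[(r_B-\ell_B)(a)(x),y]_A+\ell_B((r_A-\ell_A)(y)(a))(x)+\ell_B((\ell_A-r_A)(x)(a))(y),$$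 $$r_A(x)([a,b]_B-[b,a]_B)=[(\ell_A-r_A)(x)(b),a]_B+[(r_A-\ell_A)(x)(a),b]_B+\ell_A((r_B-\ell_B)(b)(x))(a)+\ell_A((\ell_B-r_B)(a)(x))(b).$$ A matched pair of Nijenhuis left Alia algebras $((A,N_A),(B,N_B),\ell_A,r_A,\ell_B,r_B)$ is a matched pair of the left Alia algebras such that $((B,\ell_A,r_A),N_B)$ is a representation of $((A,[,]_A),N_A)$ and $((A,\ell_B,r_B),N_A)$ is a representation of $((B,[,]_B),N_B)$. A Manin triple as in (2): a left Alia algebra structure $[,]_{A\oplus A^*}$ on $A\oplus A^*$ containing $(A,[,])$ and $(A^*,[,]_{A^*})$ as left Alia subalgebras, such that $\mathcal B(x+a^*,y+b^* )=\langle a^*,y\rangle+\langle x,b^*\rangle$ is invariant, i.e. $\mathcal B([u,v],w)=\mathcal B(u,[w,v]-[v,w])$ for all $u,v,w\in A\oplus A^*$, and such that $((A\oplus A^*,[,]_{A\oplus A^*}),N+S^* )$ is a Nijenhuis left Alia algebra, where $(N+S^* )(x+a^* )=N(x)+S^*(a^* )$. Write $\Delta(x)=x_{(1)}\otimes x_{(2)}$ (Sweedler notation). A left Alia coalgebra is $(A,\Delta)$ with $$x_{(1)(2)}\otimes x_{(1)(1)}\otimes x_{(2)}+x_{(1)(1)}\otimes x_{(2)}\otimes x_{(1)(2)}+x_{(2)}\otimes x_{(1)(2)}\otimes x_{(1)(1)}=x_{(1)(1)}\otimes x_{(1)(2)}\otimes x_{(2)}+x_{(1)(2)}\otimes x_{(2)}\otimes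 x_{(1)(1)}+x_{(2)}\otimes x_{(1)(1)}\otimes x_{(1)(2)},$$ where $x_{(1)(1)}\otimes x_{(1)(2)}\otimes x_{(2)}=(\Delta\otimes\mathrm{id})\Delta(x)$. A left Alia bialgebra is $(A,[,],\Delta)$ with $(A,[,])$ a left Alia algebra, $(A,\Delta)$ a left Alia coalgebra and $(\tau-\mathrm{id}^{\otimes 2})(\Delta([x,y]-[y,x]))=(\tau-\mathrm{id}^{\otimes 2})((\mathcal R(y)\otimes\mathrm{id})\Delta(x)-(\mathcal R(x)\otimes\mathrm{id})\Delta(y))$, $\tau$ the flip. A Nijenhuis left Alia bialgebra $((A,[,],\Delta),N,S)$ is a left Alia bialgebra such that $((A,[,]),N)$ is a Nijenhuis left Alia algebra and for all $x,y\in A$: $S(x_{(1)})\otimes S(x_{(2)})+S^2(x)_{(1)}\otimes S^2(x)_{(2)}=S(S(x)_{(1)})\otimes S(x)_{(2)}+S(x)_{(1)}\otimes S(S(x)_{(2)})$; $S[N(x),y]+[x,S^2(y)]=S[x,S(y)]+[N(x),S(y)]$; $S[x,N(y)]+[S^2(x),y]=S[S(x),y]+[S(x),N(y)]$; $S(N(x)_{(1)})\otimes N(x)_{(2)}+x_{(1)}\otimes N^2(x_{(2)})=S(x_{(1)})\otimes N(x_{(2)})+N(x)_{(1)}\otimes N(N(x)_{(2)})$; $N(x)_{(1)}\otimes S(N(x)_{(2)})+N^2(x_{(1)})\otimes x_{(2)}=N(x_{(1)})\otimes S(x_{(2)})+N(N(x)_{(1)})\otimes N(x)_{(2)}$. 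*)

theory Defs
  imports Complex_Main "HOL-Library.Function_Algebras" "HOL-Library.Product_Plus"
begin

section \<open>Linear algebra on carriers\<close>

text \<open>
  The dual space and the tensor powers of a vector space \<open>(UNIV :: 'a set, s)\<close> over the field
  \<open>'k\<close> are subspaces of function types. All notions are therefore relative to a carrier, which is
  a subspace of the ambient type. Nothing is claimed about values outside the carrier.
\<close>

definition vec_space_on :: "('k::field \<Rightarrow> 'v::ab_group_add \<Rightarrow> 'v) \<Rightarrow> 'v set \<Rightarrow> bool" where
  "vec_space_on s V \<longleftrightarrow> vector_space s \<and> module.subspace s V"

definition linear_on ::
  "('k::field \<Rightarrow> 'v::ab_group_add \<Rightarrow> 'v) \<Rightarrow> 'v set \<Rightarrow> ('k \<Rightarrow> 'w::ab_group_add \<Rightarrow> 'w) \<Rightarrow> 'w set \<Rightarrow> ('v \<Rightarrow> 'w) \<Rightarrow> bool"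
  where
  "linear_on s V t W f \<longleftrightarrow>
     (\<forall>x\<in>V. f x \<in> W) \<and>
     (\<forall>x\<in>V. \<forall>y\<in>V. f (x + y) = f x + f y) \<and>
     (\<forall>c. \<forall>x\<in>V. f (s c x) = t c (f x))"

definition bilinear_on ::
  "('k::field \<Rightarrow> 'v::ab_group_add \<Rightarrow> 'v) \<Rightarrow> 'v set \<Rightarrow> ('k \<Rightarrow> 'w::ab_group_add \<Rightarrow> 'w) \<Rightarrow> 'w set \<Rightarrow>
   ('k \<Rightarrow> 'u::ab_group_add \<Rightarrow> 'u) \<Rightarrow> 'u set \<Rightarrow> ('v \<Rightarrow> 'w \<Rightarrow> 'u) \<Rightarrow> bool"
  where
  "bilinear_on s V t W u U b \<longleftrightarrow>
     (\<forall>x\<in>V. linear_on t W u U (b x)) \<and> (\<forall>y\<in>W. linear_on s V u U (\<lambda>x. b x y))"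

definition fscale :: "'k::field \<Rightarrow> ('x \<Rightarrow> 'k) \<Rightarrow> 'x \<Rightarrow> 'k" where
  "fscale c f = (\<lambda>x. c * f x)"

definition prod_scale :: "('k \<Rightarrow> 'v \<Rightarrow> 'v) \<Rightarrow> ('k \<Rightarrow> 'w \<Rightarrow> 'w) \<Rightarrow> 'k \<Rightarrow> 'v \<times> 'w \<Rightarrow> 'v \<times> 'w" where
  "prod_scale s t c p = (s c (fst p), t c (snd p))"

definition dual :: "('k::field \<Rightarrow> 'a::ab_group_add \<Rightarrow> 'a) \<Rightarrow> ('a \<Rightarrow> 'k) set" where
  "dual s = {f. Vector_Spaces.linear s (*) f}"

definition transpose_map :: "('a \<Rightarrow> 'a) \<Rightarrow> ('a \<Rightarrow> 'k) \<Rightarrow> ('a \<Rightarrow> 'k)" where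
  "transpose_map S f = f \<circ> S"

text \<open>The inverse of the evaluation map from the space to its bidual.\<close>

definition undouble :: "('k::field \<Rightarrow> 'a::ab_group_add \<Rightarrow> 'a) \<Rightarrow> (('a \<Rightarrow> 'k) \<Rightarrow> 'k) \<Rightarrow> 'a" where
  "undouble s \<Phi> = (THE x. \<forall>f\<in>dual s. f x = \<Phi> f)"


section \<open>Left Alia algebras, representations, matched pairs\<close>

definition left_alia ::
  "('k::field \<Rightarrow> 'v::ab_group_add \<Rightarrow> 'v) \<Rightarrow> 'v set \<Rightarrow> ('v \<Rightarrow> 'v \<Rightarrow> 'v) \<Rightarrow> bool" where
  "left_alia s V br \<longleftrightarrow>
     vec_space_on s V \<and> bilinear_on s V s V s V br \<and>
     (\<forall>x\<in>V. \<forall>y\<in>V. \<forall>z\<in>V.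
        br (br x y) z + br (br y z) x + br (br z x) y = br (br y x) z + br (br z y) x + br (br x z) y)"

definition nijenhuis_left_alia ::
  "('k::field \<Rightarrow> 'v::ab_group_add \<Rightarrow> 'v) \<Rightarrow> 'v set \<Rightarrow> ('v \<Rightarrow> 'v \<Rightarrow> 'v) \<Rightarrow> ('v \<Rightarrow> 'v) \<Rightarrow> bool" where
  "nijenhuis_left_alia s V br N \<longleftrightarrow>
     left_alia s V br \<and> linear_on s V s V N \<and>
     (\<forall>x\<in>V. \<forall>y\<in>V. br (N x) (N y) + N (N (br x y)) = N (br (N x) y + br x (N y)))"

definition alia_rep ::
  "('k::field \<Rightarrow> 'a::ab_group_add \<Rightarrow> 'a) \<Rightarrow> 'a set \<Rightarrow> ('a \<Rightarrow> 'a \<Rightarrow> 'a) \<Rightarrow>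
   ('k \<Rightarrow> 'v::ab_group_add \<Rightarrow> 'v) \<Rightarrow> 'v set \<Rightarrow> ('a \<Rightarrow> 'v \<Rightarrow> 'v) \<Rightarrow> ('a \<Rightarrow> 'v \<Rightarrow> 'v) \<Rightarrow> bool" where
  "alia_rep s A br t V l r \<longleftrightarrow>
     vec_space_on t V \<and> bilinear_on s A t V t V l \<and> bilinear_on s A t V t V r \<and>
     (\<forall>x\<in>A. \<forall>y\<in>A. \<forall>v\<in>V.
        l (br x y) v - l (br y x) v = r x (r y v - l y v) - r y (r x v - l x v))"

definition nijenhuis_rep ::
  "('k::field \<Rightarrow> 'a::ab_group_add \<Rightarrow> 'a) \<Rightarrow> 'a set \<Rightarrow> ('a \<Rightarrow> 'a \<Rightarrow> 'a) \<Rightarrow> ('a \<Rightarrow> 'a) \<Rightarrow>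
   ('k \<Rightarrow> 'v::ab_group_add \<Rightarrow> 'v) \<Rightarrow> 'v set \<Rightarrow> ('a \<Rightarrow> 'v \<Rightarrow> 'v) \<Rightarrow> ('a \<Rightarrow> 'v \<Rightarrow> 'v) \<Rightarrow> ('v \<Rightarrow> 'v) \<Rightarrow> bool"
  where
  "nijenhuis_rep s A br N t V l r \<alpha> \<longleftrightarrow>
     alia_rep s A br t V l r \<and> linear_on t V t V \<alpha> \<and>
     (\<forall>x\<in>A. \<forall>v\<in>V. l (N x) (\<alpha> v) + \<alpha> (\<alpha> (l x v)) = \<alpha> (l (N x) v) + \<alpha> (l x (\<alpha> v))) \<and>
     (\<forall>x\<in>A. \<forall>v\<in>V. r (N x) (\<alpha> v) + \<alpha> (\<alpha> (r x v)) = \<alpha> (r (N x) v) + \<alpha> (r x (\<alpha> v)))"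

definition matched_pair ::
  "('k::field \<Rightarrow> 'a::ab_group_add \<Rightarrow> 'a) \<Rightarrow> 'a set \<Rightarrow> ('a \<Rightarrow> 'a \<Rightarrow> 'a) \<Rightarrow>
   ('k \<Rightarrow> 'b::ab_group_add \<Rightarrow> 'b) \<Rightarrow> 'b set \<Rightarrow> ('b \<Rightarrow> 'b \<Rightarrow> 'b) \<Rightarrow>
   ('a \<Rightarrow> 'b \<Rightarrow> 'b) \<Rightarrow> ('a \<Rightarrow> 'b \<Rightarrow> 'b) \<Rightarrow> ('b \<Rightarrow> 'a \<Rightarrow> 'a) \<Rightarrow> ('b \<Rightarrow> 'a \<Rightarrow> 'a) \<Rightarrow> bool" where
  "matched_pair s A brA t B brB lA rA lB rB \<longleftrightarrow>
     left_alia s A brA \<and> left_alia t B brB \<and>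
     alia_rep s A brA t B lA rA \<and> alia_rep t B brB s A lB rB \<and>
     (\<forall>x\<in>A. \<forall>y\<in>A. \<forall>a\<in>B.
        rB a (brA x y - brA y x) =
          brA (lB a y - rB a y) x + brA (rB a x - lB a x) y
          + lB (rA y a - lA y a) x + lB (lA x a - rA x a) y) \<and>
     (\<forall>x\<in>A. \<forall>a\<in>B. \<forall>b\<in>B.
        rA x (brB a b - brB b a) =
          brB (lA x b - rA x b) a + brB (rA x a - lA x a) b
          + lA (rB b x - lB b x) a + lA (lB a x - rB a x) b)"

definition nijenhuis_matched_pair ::
  "('k::field \<Rightarrow> 'a::ab_group_add \<Rightarrow> 'a) \<Rightarrow> 'a set \<Rightarrow> ('a \<Rightarrow> 'a \<Rightarrow> 'a) \<Rightarrow> ('a \<Rightarrow> 'a) \<Rightarrow>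
   ('k \<Rightarrow> 'b::ab_group_add \<Rightarrow> 'b) \<Rightarrow> 'b set \<Rightarrow> ('b \<Rightarrow> 'b \<Rightarrow> 'b) \<Rightarrow> ('b \<Rightarrow> 'b) \<Rightarrow>
   ('a \<Rightarrow> 'b \<Rightarrow> 'b) \<Rightarrow> ('a \<Rightarrow> 'b \<Rightarrow> 'b) \<Rightarrow> ('b \<Rightarrow> 'a \<Rightarrow> 'a) \<Rightarrow> ('b \<Rightarrow> 'a \<Rightarrow> 'a) \<Rightarrow> bool" where
  "nijenhuis_matched_pair s A brA NA t B brB NB lA rA lB rB \<longleftrightarrow>
     nijenhuis_left_alia s A brA NA \<and> nijenhuis_left_alia t B brB NB \<and>
     matched_pair s A brA t B brB lA rA lB rB \<and>
     nijenhuis_rep s A brA NA t B lA rA NB \<and>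
     nijenhuis_rep t B brB NB s A lB rB NA"

definition Lop :: "('v \<Rightarrow> 'v \<Rightarrow> 'v) \<Rightarrow> 'v \<Rightarrow> 'v \<Rightarrow> 'v" where
  "Lop br x y = br x y"

definition Rop :: "('v \<Rightarrow> 'v \<Rightarrow> 'v) \<Rightarrow> 'v \<Rightarrow> 'v \<Rightarrow> 'v" where
  "Rop br x y = br y x"

definition dual_rep :: "('a \<Rightarrow> 'v \<Rightarrow> 'v) \<Rightarrow> 'a \<Rightarrow> ('v \<Rightarrow> 'k::field) \<Rightarrow> ('v \<Rightarrow> 'k)" where
  "dual_rep \<rho> x u = (\<lambda>v. - u (\<rho> x v))"

text \<open>
  For a map \<open>\<rho>\<close> from the dual space to its own endomorphisms, \<open>dual_rep \<rho>\<close> acts on the bidual;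
  this is the same action transported to the original space along the evaluation map.
\<close>

definition dual_rep_on_base ::
  "('k::field \<Rightarrow> 'a::ab_group_add \<Rightarrow> 'a) \<Rightarrow> (('a \<Rightarrow> 'k) \<Rightarrow> ('a \<Rightarrow> 'k) \<Rightarrow> ('a \<Rightarrow> 'k)) \<Rightarrow> ('a \<Rightarrow> 'k) \<Rightarrow> 'a \<Rightarrow> 'a"
  where
  "dual_rep_on_base s \<rho> a x = undouble s (dual_rep \<rho> a (\<lambda>f. f x))"


section \<open>Manin triples\<close>

definition pairing_form :: "'a \<times> ('a \<Rightarrow> 'k::field) \<Rightarrow> 'a \<times> ('a \<Rightarrow> 'k) \<Rightarrow> 'k" where
  "pairing_form u v = snd u (fst v) + snd v (fst u)"

definition nijenhuis_manin_triple ::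
  "('k::field \<Rightarrow> 'a::ab_group_add \<Rightarrow> 'a) \<Rightarrow> ('a \<Rightarrow> 'a \<Rightarrow> 'a) \<Rightarrow> ('a \<Rightarrow> 'a) \<Rightarrow>
   (('a \<Rightarrow> 'k) \<Rightarrow> ('a \<Rightarrow> 'k) \<Rightarrow> ('a \<Rightarrow> 'k)) \<Rightarrow> (('a \<Rightarrow> 'k) \<Rightarrow> ('a \<Rightarrow> 'k)) \<Rightarrow>
   ('a \<times> ('a \<Rightarrow> 'k) \<Rightarrow> 'a \<times> ('a \<Rightarrow> 'k) \<Rightarrow> 'a \<times> ('a \<Rightarrow> 'k)) \<Rightarrow> bool" where
  "nijenhuis_manin_triple s br N brd M BR \<longleftrightarrow>
     nijenhuis_left_alia s UNIV br N \<and>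
     nijenhuis_left_alia fscale (dual s) brd M \<and>
     nijenhuis_left_alia (prod_scale s fscale) (UNIV \<times> dual s) BR (\<lambda>(x, f). (N x, M f)) \<and>
     (\<forall>x y. BR (x, 0) (y, 0) = (br x y, 0)) \<and>
     (\<forall>f\<in>dual s. \<forall>g\<in>dual s. BR (0, f) (0, g) = (0, brd f g)) \<and>
     (\<forall>u\<in>UNIV \<times> dual s. \<forall>v\<in>UNIV \<times> dual s. \<forall>w\<in>UNIV \<times> dual s.
        pairing_form (BR u v) w = pairing_form u (BR w v - BR v w))"


section \<open>Tensor powers\<close>

text \<open>
  The tensor square of \<open>A\<close> is realised inside the functions on pairs of functionals:
  \<open>a \<otimes> b\<close> is the form \<open>(f, g) \<mapsto> f a * g b\<close>, and the tensor square is the span of these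
  (functionals separate points of a vector space, so this span has the universal property; see
  \<open>sum_tens2_lift\<close>, \<open>sum_tens3_lift\<close> and \<open>tensor2_sum_list\<close> below). The value \<open>0\<close> off the dual
  space makes \<open>\<otimes>\<close> multilinear as a map into the full function space.
\<close>

definition tens2 ::
  "('k::field \<Rightarrow> 'a::ab_group_add \<Rightarrow> 'a) \<Rightarrow> 'a \<Rightarrow> 'a \<Rightarrow> (('a \<Rightarrow> 'k) \<times> ('a \<Rightarrow> 'k) \<Rightarrow> 'k)" where
  "tens2 s a b = (\<lambda>(f, g). if f \<in> dual s \<and> g \<in> dual s then f a * g b else 0)"

definition tens3 ::
  "('k::field \<Rightarrow> 'a::ab_group_add \<Rightarrow> 'a) \<Rightarrow> 'a \<Rightarrow> 'a \<Rightarrow> 'a \<Rightarrow> (('a \<Rightarrow> 'k) \<times> ('a \<Rightarrow> 'k) \<times> ('a \<Rightarrow> 'k) \<Rightarrow> 'k)"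
  where
  "tens3 s a b c =
     (\<lambda>(f, g, h). if f \<in> dual s \<and> g \<in> dual s \<and> h \<in> dual s then f a * g b * h c else 0)"

definition tensor2 ::
  "('k::field \<Rightarrow> 'a::ab_group_add \<Rightarrow> 'a) \<Rightarrow> (('a \<Rightarrow> 'k) \<times> ('a \<Rightarrow> 'k) \<Rightarrow> 'k) set" where
  "tensor2 s = module.span fscale (range (\<lambda>(a, b). tens2 s a b))"

text \<open>
  Sweedler notation: if \<open>t = \<Sum> t\<^sub>1 \<otimes> t\<^sub>2\<close>, then \<open>sweedler s t h = \<Sum> h t\<^sub>1 t\<^sub>2\<close>. For bilinear \<open>h\<close> this is
  the value at \<open>t\<close> of the linear map induced by \<open>h\<close>, independently of the chosen
  decomposition (\<open>sweedler_sum\<close>).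
\<close>

definition sweedler ::
  "('k::field \<Rightarrow> 'a::ab_group_add \<Rightarrow> 'a) \<Rightarrow> (('a \<Rightarrow> 'k) \<times> ('a \<Rightarrow> 'k) \<Rightarrow> 'k) \<Rightarrow>
   ('a \<Rightarrow> 'a \<Rightarrow> 'w::ab_group_add) \<Rightarrow> 'w" where
  "sweedler s t h =
     (\<Sum>(a, b)\<leftarrow>(SOME ps. (\<Sum>(a, b)\<leftarrow>ps. tens2 s a b) = t). h a b)"

definition map_tens2 ::
  "('k::field \<Rightarrow> 'a::ab_group_add \<Rightarrow> 'a) \<Rightarrow> ('a \<Rightarrow> 'a) \<Rightarrow> ('a \<Rightarrow> 'a) \<Rightarrow>
   (('a \<Rightarrow> 'k) \<times> ('a \<Rightarrow> 'k) \<Rightarrow> 'k) \<Rightarrow> (('a \<Rightarrow> 'k) \<times> ('a \<Rightarrow> 'k) \<Rightarrow> 'k)" where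
  "map_tens2 s f g t = sweedler s t (\<lambda>a b. tens2 s (f a) (g b))"

definition flip ::
  "('k::field \<Rightarrow> 'a::ab_group_add \<Rightarrow> 'a) \<Rightarrow>
   (('a \<Rightarrow> 'k) \<times> ('a \<Rightarrow> 'k) \<Rightarrow> 'k) \<Rightarrow> (('a \<Rightarrow> 'k) \<times> ('a \<Rightarrow> 'k) \<Rightarrow> 'k)" where
  "flip s t = sweedler s t (\<lambda>a b. tens2 s b a)"

text \<open>The pairing of \<open>f \<otimes> g\<close>, for functionals \<open>f\<close> and \<open>g\<close>, with a 2-tensor.\<close>

definition tens2_pairing ::
  "('k::field \<Rightarrow> 'a::ab_group_add \<Rightarrow> 'a) \<Rightarrow> ('a \<Rightarrow> 'k) \<Rightarrow> ('a \<Rightarrow> 'k) \<Rightarrow> (('a \<Rightarrow> 'k) \<times> ('a \<Rightarrow> 'k) \<Rightarrow> 'k) \<Rightarrow> 'k"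
  where
  "tens2_pairing s f g t = sweedler s t (\<lambda>a b. f a * g b)"

text \<open>
  For \<open>(\<Delta> \<otimes> id) (\<Delta> x) = \<Sum> p \<otimes> q \<otimes> v\<close>, that is \<open>p = x\<^sub>(\<^sub>1\<^sub>)\<^sub>(\<^sub>1\<^sub>)\<close>, \<open>q = x\<^sub>(\<^sub>1\<^sub>)\<^sub>(\<^sub>2\<^sub>)\<close> and \<open>v = x\<^sub>(\<^sub>2\<^sub>)\<close>, this is
  \<open>\<Sum> h p q v\<close>.
\<close>

definition sweedler3 ::
  "('k::field \<Rightarrow> 'a::ab_group_add \<Rightarrow> 'a) \<Rightarrow> ('a \<Rightarrow> (('a \<Rightarrow> 'k) \<times> ('a \<Rightarrow> 'k) \<Rightarrow> 'k)) \<Rightarrow> 'a \<Rightarrow>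
   ('a \<Rightarrow> 'a \<Rightarrow> 'a \<Rightarrow> 'w::ab_group_add) \<Rightarrow> 'w" where
  "sweedler3 s \<Delta> x h = sweedler s (\<Delta> x) (\<lambda>u v. sweedler s (\<Delta> u) (\<lambda>p q. h p q v))"


section \<open>Left Alia coalgebras and bialgebras\<close>

definition left_alia_coalgebra ::
  "('k::field \<Rightarrow> 'a::ab_group_add \<Rightarrow> 'a) \<Rightarrow> ('a \<Rightarrow> (('a \<Rightarrow> 'k) \<times> ('a \<Rightarrow> 'k) \<Rightarrow> 'k)) \<Rightarrow> bool" where
  "left_alia_coalgebra s \<Delta> \<longleftrightarrow>
     vector_space s \<and> linear_on s UNIV fscale (tensor2 s) \<Delta> \<and>
     (\<forall>x. sweedler3 s \<Delta> x (\<lambda>p q v. tens3 s q p v)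
          + sweedler3 s \<Delta> x (\<lambda>p q v. tens3 s p v q)
          + sweedler3 s \<Delta> x (\<lambda>p q v. tens3 s v q p)
        = sweedler3 s \<Delta> x (\<lambda>p q v. tens3 s p q v)
          + sweedler3 s \<Delta> x (\<lambda>p q v. tens3 s q v p)
          + sweedler3 s \<Delta> x (\<lambda>p q v. tens3 s v p q))"

definition left_alia_bialgebra ::
  "('k::field \<Rightarrow> 'a::ab_group_add \<Rightarrow> 'a) \<Rightarrow> ('a \<Rightarrow> 'a \<Rightarrow> 'a) \<Rightarrow>
   ('a \<Rightarrow> (('a \<Rightarrow> 'k) \<times> ('a \<Rightarrow> 'k) \<Rightarrow> 'k)) \<Rightarrow> bool" where
  "left_alia_bialgebra s br \<Delta> \<longleftrightarrow>
     left_alia s UNIV br \<and> left_alia_coalgebra s \<Delta> \<and>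
     (\<forall>x y.
        let t = \<Delta> (br x y - br y x);
            t' = map_tens2 s (Rop br y) id (\<Delta> x) - map_tens2 s (Rop br x) id (\<Delta> y)
        in flip s t - t = flip s t' - t')"

definition nijenhuis_left_alia_bialgebra ::
  "('k::field \<Rightarrow> 'a::ab_group_add \<Rightarrow> 'a) \<Rightarrow> ('a \<Rightarrow> 'a \<Rightarrow> 'a) \<Rightarrow>
   ('a \<Rightarrow> (('a \<Rightarrow> 'k) \<times> ('a \<Rightarrow> 'k) \<Rightarrow> 'k)) \<Rightarrow> ('a \<Rightarrow> 'a) \<Rightarrow> ('a \<Rightarrow> 'a) \<Rightarrow> bool" where
  "nijenhuis_left_alia_bialgebra s br \<Delta> N S \<longleftrightarrow>
     left_alia_bialgebra s br \<Delta> \<and> nijenhuis_left_alia s UNIV br N \<and> linear_on s UNIV s UNIV S \<and>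
     (\<forall>x. map_tens2 s S S (\<Delta> x) + \<Delta> (S (S x))
          = map_tens2 s S id (\<Delta> (S x)) + map_tens2 s id S (\<Delta> (S x))) \<and>
     (\<forall>x y. S (br (N x) y) + br x (S (S y)) = S (br x (S y)) + br (N x) (S y)) \<and>
     (\<forall>x y. S (br x (N y)) + br (S (S x)) y = S (br (S x) y) + br (S x) (N y)) \<and>
     (\<forall>x. map_tens2 s S id (\<Delta> (N x)) + map_tens2 s id (N \<circ> N) (\<Delta> x)
          = map_tens2 s S N (\<Delta> x) + map_tens2 s id N (\<Delta> (N x))) \<and>
     (\<forall>x. map_tens2 s id S (\<Delta> (N x)) + map_tens2 s (N \<circ> N) id (\<Delta> x)
          = map_tens2 s N S (\<Delta> x) + map_tens2 s N id (\<Delta> (N x)))"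


section \<open>Adequacy of the tensor powers\<close>

lemma sum_list_apply:
  fixes F :: "'x \<Rightarrow> 'y \<Rightarrow> 'k::comm_monoid_add"
  shows "(\<Sum>p\<leftarrow>ps. F p) y = (\<Sum>p\<leftarrow>ps. F p y)"
  by (induction ps) auto

lemma vector_space_fscale: "vector_space (fscale :: 'k::field \<Rightarrow> ('x \<Rightarrow> 'k) \<Rightarrow> 'x \<Rightarrow> 'k)"
  by unfold_locales (auto simp: fscale_def fun_eq_iff algebra_simps)

lemma (in vector_space) tens2_scale_left: "tens2 scale (scale c a) b = fscale c (tens2 scale a b)"
proof -
  have "f (scale c a) = c * f a" if "f \<in> dual scale" for f
    using that by (auto simp: dual_def Vector_Spaces.linear_def module_hom.scale)
  then show ?thesis
    by (auto simp: tens2_def fscale_def fun_eq_iff)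
qed

lemma (in vector_space) tensor2_sum_list:
  "tensor2 scale = {t. \<exists>ps. (\<Sum>(a, b)\<leftarrow>ps. tens2 scale a b) = t}"
proof -
  interpret F: vector_space "fscale :: 'a \<Rightarrow> _"
    by (rule vector_space_fscale)
  let ?T = "{t. \<exists>ps. (\<Sum>(a, b)\<leftarrow>ps. tens2 scale a b) = t}"
  have scale: "fscale c (\<Sum>(a, b)\<leftarrow>ps. tens2 scale a b) = (\<Sum>(a, b)\<leftarrow>map (\<lambda>(a, b). (scale c a, b)) ps. tens2 scale a b)"
    for c ps
    by (induction ps) (auto simp: tens2_scale_left fscale_def fun_eq_iff distrib_left)
  have "F.subspace ?T"
  proof (rule F.subspaceI)
    show "0 \<in> ?T" by (auto intro: exI[of _ "[]"])
    show "x + y \<in> ?T" if "x \<in> ?T" "y \<in> ?T" for x y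
    proof -
      from that obtain ps qs where "(\<Sum>(a, b)\<leftarrow>ps. tens2 scale a b) = x" "(\<Sum>(a, b)\<leftarrow>qs. tens2 scale a b) = y"
        by auto
      then have "(\<Sum>(a, b)\<leftarrow>ps @ qs. tens2 scale a b) = x + y" by simp
      then show ?thesis by blast
    qed
    show "fscale c x \<in> ?T" if "x \<in> ?T" for c x
    proof -
      from that obtain ps where "(\<Sum>(a, b)\<leftarrow>ps. tens2 scale a b) = x"
        by blast
      with scale[of c ps] show ?thesis
        by (metis (mono_tags, lifting) mem_Collect_eq)
    qed
  qed
  moreover have "range (\<lambda>(a, b). tens2 scale a b) \<subseteq> ?T"
  proof safe
    fix a b show "\<exists>ps. (\<Sum>(a, b)\<leftarrow>ps. tens2 scale a b) = tens2 scale a b"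
      by (rule exI[of _ "[(a, b)]"]) simp
  qed
  ultimately have "tensor2 scale \<subseteq> ?T"
    unfolding tensor2_def by (rule F.span_minimal[rotated])
  moreover have "(\<Sum>(a, b)\<leftarrow>ps. tens2 scale a b) \<in> tensor2 scale" for ps
    unfolding tensor2_def
  proof (induction ps)
    case Nil
    show ?case by (simp only: list.map sum_list.Nil F.span_zero)
  next
    case (Cons p ps)
    show ?case
      unfolding list.map sum_list.Cons
      by (rule F.span_add[OF F.span_base Cons.IH]) (rule rangeI)
  qed
  ultimately show ?thesis by blast
qed

context finite_dimensional_vector_space
begin

definition coord :: "'b \<Rightarrow> 'b \<Rightarrow> 'a" where
  "coord e x = representation Basis x e"

lemma coord_dual: "coord e \<in> dual scale"
  unfolding dual_def coord_def mem_Collect_eq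
proof (unfold_locales)
qed (auto simp: independent_Basis span_Basis representation_add representation_scale algebra_simps)

lemma sum_coord: "(\<Sum>e\<in>Basis. coord e x *s e) = x"
  unfolding coord_def
  by (rule sum_representation_eq) (auto simp: independent_Basis span_Basis finite_Basis)

lemma linear_on_expand:
  assumes t: "vector_space t" and h: "linear_on scale UNIV t UNIV h"
  shows "h x = (\<Sum>e\<in>Basis. t (coord e x) (h e))"
proof -
  interpret T: vector_space t by (rule t)
  interpret h: Vector_Spaces.linear scale t h
    by unfold_locales (use h in \<open>auto simp: linear_on_def\<close>)
  have "h x = h (\<Sum>e\<in>Basis. coord e x *s e)" by (simp add: sum_coord)
  then show ?thesis by (simp only: h.sum h.scale)
qed

lemma sum_tens2_expand:
  assumes t: "vector_space t" and h: "bilinear_on scale UNIV scale UNIV t UNIV h"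
  shows "(\<Sum>(a, b)\<leftarrow>ps. h a b) =
    (\<Sum>e\<in>Basis. \<Sum>e'\<in>Basis. t ((\<Sum>(a, b)\<leftarrow>ps. tens2 scale a b) (coord e, coord e')) (h e e'))"
proof -
  interpret T: vector_space t by (rule t)
  have *: "h a b = (\<Sum>e\<in>Basis. \<Sum>e'\<in>Basis. t (coord e a * coord e' b) (h e e'))" for a b
  proof -
    have "h a b = (\<Sum>e\<in>Basis. t (coord e a) (h e b))"
      using h by (intro linear_on_expand[OF t, of "\<lambda>a. h a b"]) (auto simp: bilinear_on_def)
    also have "\<dots> = (\<Sum>e\<in>Basis. t (coord e a) (\<Sum>e'\<in>Basis. t (coord e' b) (h e e')))"
      by (intro sum.cong refl arg_cong[of _ _ "t _"] linear_on_expand[OF t])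
         (use h in \<open>auto simp: bilinear_on_def\<close>)
    finally show ?thesis by (simp add: T.scale_sum_right)
  qed
  show ?thesis
  proof (induction ps)
    case (Cons p ps)
    obtain a b where p: "p = (a, b)" by force
    show ?case
      by (simp add: p Cons.IH *[of a b] tens2_def coord_dual T.scale_left_distrib sum.distrib)
  qed simp
qed

theorem sum_tens2_lift:
  assumes "vector_space t" and "bilinear_on scale UNIV scale UNIV t UNIV h"
    and "(\<Sum>(a, b)\<leftarrow>ps. tens2 scale a b) = (\<Sum>(a, b)\<leftarrow>qs. tens2 scale a b)"
  shows "(\<Sum>(a, b)\<leftarrow>ps. h a b) = (\<Sum>(a, b)\<leftarrow>qs. h a b)"
  using assms by (simp add: sum_tens2_expand)

theorem sweedler_sum:
  assumes "vector_space t" and "bilinear_on scale UNIV scale UNIV t UNIV h"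
  shows "sweedler scale (\<Sum>(a, b)\<leftarrow>ps. tens2 scale a b) h = (\<Sum>(a, b)\<leftarrow>ps. h a b)"
  unfolding sweedler_def
  by (rule sum_tens2_lift[OF assms])
     (rule someI[where P = "\<lambda>qs. (\<Sum>(a, b)\<leftarrow>qs. tens2 scale a b) = (\<Sum>(a, b)\<leftarrow>ps. tens2 scale a b)"], rule refl)

theorem sum_tens3_lift:
  assumes t: "vector_space t"
    and h1: "\<And>b c. linear_on scale UNIV t UNIV (\<lambda>a. h a b c)"
    and h2: "\<And>a c. linear_on scale UNIV t UNIV (\<lambda>b. h a b c)"
    and h3: "\<And>a b. linear_on scale UNIV t UNIV (\<lambda>c. h a b c)"
    and eq: "(\<Sum>(a, b, c)\<leftarrow>ps. tens3 scale a b c) = (\<Sum>(a, b, c)\<leftarrow>qs. tens3 scale a b c)"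
  shows "(\<Sum>(a, b, c)\<leftarrow>ps. h a b c) = (\<Sum>(a, b, c)\<leftarrow>qs. h a b c)"
proof -
  interpret T: vector_space t by (rule t)
  have *: "h a b c = (\<Sum>e\<in>Basis. \<Sum>e'\<in>Basis. \<Sum>e''\<in>Basis.
      t (coord e a * coord e' b * coord e'' c) (h e e' e''))" for a b c
  proof -
    have "h a b c = (\<Sum>e\<in>Basis. t (coord e a) (h e b c))"
      by (rule linear_on_expand[OF t h1])
    also have "\<dots> = (\<Sum>e\<in>Basis. t (coord e a) (\<Sum>e'\<in>Basis. t (coord e' b) (h e e' c)))"
      by (intro sum.cong refl arg_cong[of _ _ "t _"] linear_on_expand[OF t h2])
    also have "\<dots> = (\<Sum>e\<in>Basis. t (coord e a) (\<Sum>e'\<in>Basis. t (coord e' b)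
        (\<Sum>e''\<in>Basis. t (coord e'' c) (h e e' e''))))"
      by (intro sum.cong refl arg_cong[of _ _ "t _"] linear_on_expand[OF t h3])
    finally show ?thesis by (simp add: T.scale_sum_right mult.assoc)
  qed
  have **: "(\<Sum>(a, b, c)\<leftarrow>rs. h a b c) = (\<Sum>e\<in>Basis. \<Sum>e'\<in>Basis. \<Sum>e''\<in>Basis.
      t ((\<Sum>(a, b, c)\<leftarrow>rs. tens3 scale a b c) (coord e, coord e', coord e'')) (h e e' e''))" for rs
  proof (induction rs)
    case (Cons p rs)
    obtain a b c where p: "p = (a, b, c)" by (cases p)
    show ?case
      by (simp add: p Cons.IH *[of a b c] tens3_def coord_dual T.scale_left_distrib sum.distrib)
  qed simp
  show ?thesis by (simp only: ** eq)
qed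

end

end

theory Submission
  imports Defs
begin

text \<open>
  All three conditions are statements about one bracket on \<open>A \<oplus> A\<^sup>*\<close>, the one in which each summand
  acts on the other by the coadjoint actions \<open>\<L>\<^sup>*\<close> (from the left) and \<open>\<L>\<^sup>* - \<R>\<^sup>*\<close> (from the right).

  Matched pairs and Manin triples.  For algebras \<open>A\<close> and \<open>B\<close> acting on each other, the left Alia
  identity of the bracket on \<open>A \<oplus> B\<close> is trilinear, so it suffices to consider arguments in \<open>A\<close> or \<open>B\<close>.
  For two arguments in one summand and the third in the other, one component of the identity is the
  representation condition and the other is a matched pair equation (\<open>left_alia_bracket_iff\<close>).  The
  Nijenhuis identity splits in the same way into the conditions on Nijenhuis representations
  (\<open>nijenhuis_bracket_iff\<close>).  On \<open>A \<oplus> A\<^sup>*\<close> invariance of the pairing determines the products of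
  vectors with functionals, and they are the coadjoint actions (\<open>invariant_bracket_unique\<close>).  So there
  is only one candidate for the bracket of a Manin triple.

  Matched pairs and bialgebras.  The coadjoint actions are representations by the left Alia identities
  of \<open>A\<close> and \<open>A\<^sup>*\<close>.  Paired with a further functional or vector, the two matched pair equations are the
  same scalar identity in two vectors and two functionals, because the defect of the left Alia identity,
  paired with a fourth element by an invariant form, is alternating in all four
  (\<open>matched_pair_iff_match_form\<close>).  The compatibility of product and coproduct in a bialgebra, evaluated
  at two functionals, is again this identity (\<open>compatibility_iff\<close>).  The conditions on Nijenhuis
  representations transpose to the remaining bialgebra conditions: those for \<open>A\<^sup>*\<close> as a module to the
  ones on \<open>S\<close> and the product, those for \<open>A\<close> as a module to the ones on \<open>N\<close>, \<open>S\<close> and \<open>\<Delta>\<close>.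
  The coalgebra axioms are the left Alia structure of \<open>A\<^sup>*\<close> in dual form.
\<close>

section \<open>Linear and bilinear maps on carriers\<close>

lemma vec_space_on_closed:
  assumes "vec_space_on s V"
  shows "0 \<in> V" "x \<in> V \<Longrightarrow> y \<in> V \<Longrightarrow> x + y \<in> V" "x \<in> V \<Longrightarrow> y \<in> V \<Longrightarrow> x - y \<in> V"
    "x \<in> V \<Longrightarrow> - x \<in> V" "x \<in> V \<Longrightarrow> s c x \<in> V"
proof -
  interpret vector_space s using assms by (simp add: vec_space_on_def)
  have "subspace V" using assms by (simp add: vec_space_on_def)
  then show "0 \<in> V" "x \<in> V \<Longrightarrow> y \<in> V \<Longrightarrow> x + y \<in> V" "x \<in> V \<Longrightarrow> y \<in> V \<Longrightarrow> x - y \<in> V"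
    "x \<in> V \<Longrightarrow> - x \<in> V" "x \<in> V \<Longrightarrow> s c x \<in> V"
    by (auto intro: subspace_0 subspace_add subspace_diff subspace_neg subspace_scale)
qed

lemma linear_on_simps:
  assumes "vec_space_on s V" and "linear_on s V t W f"
  shows "x \<in> V \<Longrightarrow> f x \<in> W"
    and "x \<in> V \<Longrightarrow> y \<in> V \<Longrightarrow> f (x + y) = f x + f y"
    and "x \<in> V \<Longrightarrow> f (s c x) = t c (f x)"
    and "f 0 = 0"
    and "x \<in> V \<Longrightarrow> y \<in> V \<Longrightarrow> f (x - y) = f x - f y"
proof -
  note V = vec_space_on_closed[OF assms(1)]
  show add: "f (x + y) = f x + f y" if "x \<in> V" "y \<in> V" for x y
    using assms(2) that by (simp add: linear_on_def)
  show "x \<in> V \<Longrightarrow> f x \<in> W" "x \<in> V \<Longrightarrow> f (s c x) = t c (f x)"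
    using assms(2) by (simp_all add: linear_on_def)
  show "f 0 = 0" using add[of 0 0] V(1) by simp
  show "x \<in> V \<Longrightarrow> y \<in> V \<Longrightarrow> f (x - y) = f x - f y"
    using add[of "x - y" y] V(3) by (simp add: algebra_simps)
qed

lemma bilinear_on_simps:
  assumes "vec_space_on s V" and "vec_space_on t W" and "bilinear_on s V t W u U b"
  shows "x \<in> V \<Longrightarrow> y \<in> W \<Longrightarrow> b x y \<in> U"
    and "x \<in> V \<Longrightarrow> x' \<in> V \<Longrightarrow> y \<in> W \<Longrightarrow> b (x + x') y = b x y + b x' y"
    and "x \<in> V \<Longrightarrow> x' \<in> V \<Longrightarrow> y \<in> W \<Longrightarrow> b (x - x') y = b x y - b x' y"
    and "x \<in> V \<Longrightarrow> y \<in> W \<Longrightarrow> b (s c x) y = u c (b x y)"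
    and "y \<in> W \<Longrightarrow> b 0 y = 0"
    and "x \<in> V \<Longrightarrow> y \<in> W \<Longrightarrow> y' \<in> W \<Longrightarrow> b x (y + y') = b x y + b x y'"
    and "x \<in> V \<Longrightarrow> y \<in> W \<Longrightarrow> y' \<in> W \<Longrightarrow> b x (y - y') = b x y - b x y'"
    and "x \<in> V \<Longrightarrow> y \<in> W \<Longrightarrow> b x (t c y) = u c (b x y)"
    and "x \<in> V \<Longrightarrow> b x 0 = 0"
proof -
  have l: "linear_on s V u U (\<lambda>x. b x y)" if "y \<in> W" for y
    using assms(3) that by (simp add: bilinear_on_def)
  have r: "linear_on t W u U (b x)" if "x \<in> V" for x
    using assms(3) that by (simp add: bilinear_on_def)
  note L = linear_on_simps[OF assms(1) l] and R = linear_on_simps[OF assms(2) r]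
  show "x \<in> V \<Longrightarrow> y \<in> W \<Longrightarrow> b x y \<in> U"
    and "x \<in> V \<Longrightarrow> x' \<in> V \<Longrightarrow> y \<in> W \<Longrightarrow> b (x + x') y = b x y + b x' y"
    and "x \<in> V \<Longrightarrow> x' \<in> V \<Longrightarrow> y \<in> W \<Longrightarrow> b (x - x') y = b x y - b x' y"
    and "x \<in> V \<Longrightarrow> y \<in> W \<Longrightarrow> b (s c x) y = u c (b x y)"
    and "y \<in> W \<Longrightarrow> b 0 y = 0"
    by (simp_all add: L)
  show "x \<in> V \<Longrightarrow> y \<in> W \<Longrightarrow> y' \<in> W \<Longrightarrow> b x (y + y') = b x y + b x y'"
    and "x \<in> V \<Longrightarrow> y \<in> W \<Longrightarrow> y' \<in> W \<Longrightarrow> b x (y - y') = b x y - b x y'"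
    and "x \<in> V \<Longrightarrow> y \<in> W \<Longrightarrow> b x (t c y) = u c (b x y)"
    and "x \<in> V \<Longrightarrow> b x 0 = 0"
    by (simp_all add: R)
qed

lemma bilinear_on_diff:
  assumes "vec_space_on u U" and "bilinear_on s V t W u U b" and "bilinear_on s V t W u U b'"
  shows "bilinear_on s V t W u U (\<lambda>x y. b x y - b' x y)"
proof -
  interpret vector_space u using assms(1) by (simp add: vec_space_on_def)
  show ?thesis
    using assms(2,3)
    by (simp add: bilinear_on_def linear_on_def vec_space_on_closed[OF assms(1)] scale_right_diff_distrib)
qed

lemma vec_space_on_prod:
  assumes "vec_space_on s A" and "vec_space_on t B"
  shows "vec_space_on (prod_scale s t) (A \<times> B)"
proof -
  interpret s: vector_space s using assms(1) by (simp add: vec_space_on_def)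
  interpret t: vector_space t using assms(2) by (simp add: vec_space_on_def)
  interpret st: vector_space "prod_scale s t"
    by unfold_locales
      (auto simp: prod_scale_def s.scale_right_distrib t.scale_right_distrib
        s.scale_left_distrib t.scale_left_distrib)
  note A = vec_space_on_closed[OF assms(1)] and B = vec_space_on_closed[OF assms(2)]
  have "st.subspace (A \<times> B)"
    by (rule st.subspaceI) (auto simp: prod_scale_def A B zero_prod_def)
  then show ?thesis
    by (simp add: vec_space_on_def st.vector_space_axioms)
qed

section \<open>Left Alia structures on a direct sum\<close>

text \<open>
  All identities are measured by defects, expressions that vanish exactly when the identity holds.
  Defects are additive in each argument, so the defect of a bracket on a direct sum is the sum of its
  values at arguments from the summands.  The left Alia identity becomes the vanishing of the cyclic
  sum of \<open>[{x, y}, z]\<close>, where \<open>{x, y} = [x, y] - [y, x]\<close> is the commutator.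
\<close>

definition alia_defect :: "('v \<Rightarrow> 'v \<Rightarrow> 'v::ab_group_add) \<Rightarrow> 'v \<Rightarrow> 'v \<Rightarrow> 'v \<Rightarrow> 'v" where
  "alia_defect br x y z =
     br (br x y - br y x) z + br (br y z - br z y) x + br (br z x - br x z) y"

definition rep_defect ::
  "('a \<Rightarrow> 'a \<Rightarrow> 'a::ab_group_add) \<Rightarrow> ('a \<Rightarrow> 'v \<Rightarrow> 'v) \<Rightarrow> ('a \<Rightarrow> 'v \<Rightarrow> 'v) \<Rightarrow> 'a \<Rightarrow> 'a \<Rightarrow> 'v \<Rightarrow> 'v::ab_group_add"
  where
  "rep_defect br l r x y v = l (br x y - br y x) v - r x (r y v - l y v) + r y (r x v - l x v)"

definition match_defect ::
  "('a \<Rightarrow> 'a \<Rightarrow> 'a) \<Rightarrow> ('a \<Rightarrow> 'b \<Rightarrow> 'b) \<Rightarrow> ('a \<Rightarrow> 'b \<Rightarrow> 'b) \<Rightarrow> ('b \<Rightarrow> 'a \<Rightarrow> 'a) \<Rightarrow> ('b \<Rightarrow> 'a \<Rightarrow> 'a) \<Rightarrow>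
   'a \<Rightarrow> 'a \<Rightarrow> 'b::ab_group_add \<Rightarrow> 'a::ab_group_add" where
  "match_defect brA lA rA lB rB x y a =
     rB a (brA x y - brA y x)
     - (brA (lB a y - rB a y) x + brA (rB a x - lB a x) y
        + lB (rA y a - lA y a) x + lB (lA x a - rA x a) y)"

text \<open>
  For \<open>l\<close> a bracket and \<open>\<alpha> = N\<close> this is the defect of the Nijenhuis identity; for \<open>l\<close> an action, with
  \<open>N\<close> on the algebra and \<open>\<alpha>\<close> on the module, it is the defect of the condition on a Nijenhuis
  representation.  The common form makes the defect of a direct sum split into defects of the same kind.
\<close>

definition nij_defect ::
  "('a \<Rightarrow> 'v \<Rightarrow> 'v) \<Rightarrow> ('a \<Rightarrow> 'a) \<Rightarrow> ('v \<Rightarrow> 'v) \<Rightarrow> 'a \<Rightarrow> 'v \<Rightarrow> 'v::ab_group_add" where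
  "nij_defect l N \<alpha> x v = l (N x) (\<alpha> v) + \<alpha> (\<alpha> (l x v)) - \<alpha> (l (N x) v) - \<alpha> (l x (\<alpha> v))"

definition bicross_bracket ::
  "('a \<Rightarrow> 'a \<Rightarrow> 'a::ab_group_add) \<Rightarrow> ('b \<Rightarrow> 'b \<Rightarrow> 'b::ab_group_add) \<Rightarrow>
   ('a \<Rightarrow> 'b \<Rightarrow> 'b) \<Rightarrow> ('a \<Rightarrow> 'b \<Rightarrow> 'b) \<Rightarrow> ('b \<Rightarrow> 'a \<Rightarrow> 'a) \<Rightarrow> ('b \<Rightarrow> 'a \<Rightarrow> 'a) \<Rightarrow>
   'a \<times> 'b \<Rightarrow> 'a \<times> 'b \<Rightarrow> 'a \<times> 'b" where
  "bicross_bracket brA brB lA rA lB rB u v =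
     (brA (fst u) (fst v) + lB (snd u) (fst v) + rB (snd v) (fst u),
      brB (snd u) (snd v) + lA (fst u) (snd v) + rA (fst v) (snd u))"

lemma left_alia_iff_defect:
  assumes "vec_space_on s V" and "bilinear_on s V s V s V br"
  shows "left_alia s V br \<longleftrightarrow> (\<forall>x\<in>V. \<forall>y\<in>V. \<forall>z\<in>V. alia_defect br x y z = 0)"
proof -
  note b = bilinear_on_simps[OF assms(1,1,2)]
  have "alia_defect br x y z =
      (br (br x y) z + br (br y z) x + br (br z x) y) - (br (br y x) z + br (br z y) x + br (br x z) y)"
    if "x \<in> V" "y \<in> V" "z \<in> V" for x y z
    using that by (simp add: alia_defect_def b)
  then show ?thesis
    using assms by (simp add: left_alia_def)
qed

lemma alia_rep_iff_defect:
  assumes "vec_space_on s A" "vec_space_on t V"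
    and "bilinear_on s A s A s A br" "bilinear_on s A t V t V l" "bilinear_on s A t V t V r"
  shows "alia_rep s A br t V l r \<longleftrightarrow> (\<forall>x\<in>A. \<forall>y\<in>A. \<forall>v\<in>V. rep_defect br l r x y v = 0)"
proof -
  have "rep_defect br l r x y v =
      (l (br x y) v - l (br y x) v) - (r x (r y v - l y v) - r y (r x v - l x v))"
    if "x \<in> A" "y \<in> A" "v \<in> V" for x y v
    using that
    by (simp add: rep_defect_def bilinear_on_simps[OF assms(1,1,3)] bilinear_on_simps[OF assms(1,2,4)])
  then show ?thesis
    using assms by (simp add: alia_rep_def)
qed

lemma nijenhuis_identity_iff_defect:
  assumes "vec_space_on s V" and "bilinear_on s V s V s V br" and "linear_on s V s V N"
    and "x \<in> V" "y \<in> V"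
  shows "br (N x) (N y) + N (N (br x y)) = N (br (N x) y + br x (N y)) \<longleftrightarrow> nij_defect br N N x y = 0"
  using assms(4,5)
  by (simp add: nij_defect_def bilinear_on_simps[OF assms(1,1,2)] linear_on_simps[OF assms(1,3)]
      algebra_simps)

text \<open>
  The actions are only assumed to be bilinear, so that the representation conditions can be read off
  from the bracket on the sum.
\<close>

locale alia_actions =
  fixes s :: "'k::field \<Rightarrow> 'a::ab_group_add \<Rightarrow> 'a" and A :: "'a set" and brA :: "'a \<Rightarrow> 'a \<Rightarrow> 'a"
    and t :: "'k \<Rightarrow> 'b::ab_group_add \<Rightarrow> 'b" and B :: "'b set" and brB :: "'b \<Rightarrow> 'b \<Rightarrow> 'b"
    and lA rA :: "'a \<Rightarrow> 'b \<Rightarrow> 'b" and lB rB :: "'b \<Rightarrow> 'a \<Rightarrow> 'a"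
  assumes alia_A: "left_alia s A brA" and alia_B: "left_alia t B brB"
    and bil_lA: "bilinear_on s A t B t B lA" and bil_rA: "bilinear_on s A t B t B rA"
    and bil_lB: "bilinear_on t B s A s A lB" and bil_rB: "bilinear_on t B s A s A rB"
begin

lemma vec_A: "vec_space_on s A" and vec_B: "vec_space_on t B"
  and bil_A: "bilinear_on s A s A s A brA" and bil_B: "bilinear_on t B t B t B brB"
  using alia_A alia_B by (simp_all add: left_alia_def)

lemmas linear_simps =
  vec_space_on_closed[OF vec_A] vec_space_on_closed[OF vec_B]
  bilinear_on_simps[OF vec_A vec_A bil_A] bilinear_on_simps[OF vec_B vec_B bil_B]
  bilinear_on_simps[OF vec_A vec_B bil_lA] bilinear_on_simps[OF vec_A vec_B bil_rA]
  bilinear_on_simps[OF vec_B vec_A bil_lB] bilinear_on_simps[OF vec_B vec_A bil_rB]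

abbreviation "bracket \<equiv> bicross_bracket brA brB lA rA lB rB"

lemma bilinear_bracket:
  "bilinear_on (prod_scale s t) (A \<times> B) (prod_scale s t) (A \<times> B) (prod_scale s t) (A \<times> B) bracket"
proof -
  interpret s: vector_space s using vec_A by (simp add: vec_space_on_def)
  interpret t: vector_space t using vec_B by (simp add: vec_space_on_def)
  show ?thesis
    by (auto simp: bilinear_on_def linear_on_def bicross_bracket_def prod_scale_def linear_simps
        s.scale_right_distrib t.scale_right_distrib)
qed

lemma bracket_on_A: "x \<in> A \<Longrightarrow> y \<in> A \<Longrightarrow> bracket (x, 0) (y, 0) = (brA x y, 0)"
  and bracket_on_B: "a \<in> B \<Longrightarrow> b \<in> B \<Longrightarrow> bracket (0, a) (0, b) = (0, brB a b)"
  by (simp_all add: bicross_bracket_def linear_simps)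

text \<open>
  The defect is trilinear, so it splits by the number of arguments taken from \<open>B\<close>.  One such argument
  yields the matched pair equation, two yield the representation condition for \<open>B\<close> acting on \<open>A\<close>;
  three contribute only to the component in \<open>B\<close>, a subalgebra.
\<close>

lemma fst_alia_defect_bracket:
  assumes "x \<in> A" "y \<in> A" "z \<in> A" "a \<in> B" "b \<in> B" "c \<in> B"
  shows "fst (alia_defect bracket (x, a) (y, b) (z, c)) =
    alia_defect brA x y z
    + match_defect brA lA rA lB rB x y c + match_defect brA lA rA lB rB y z a
    + match_defect brA lA rA lB rB z x b
    + rep_defect brB lB rB a b z + rep_defect brB lB rB b c x + rep_defect brB lB rB c a y"
  using assms
  by (simp add: alia_defect_def match_defect_def rep_defect_def bicross_bracket_def linear_simps
      algebra_simps)

lemma fst_nij_defect_bracket: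
  assumes N: "linear_on s A s A N" and M: "linear_on t B t B M"
    and "x \<in> A" "y \<in> A" "a \<in> B" "b \<in> B"
  shows "fst (nij_defect bracket (\<lambda>(x, f). (N x, M f)) (\<lambda>(x, f). (N x, M f)) (x, a) (y, b)) =
    nij_defect brA N N x y + nij_defect lB M N a y + nij_defect rB M N b x"
  using assms(3-)
  by (simp add: nij_defect_def bicross_bracket_def linear_simps linear_on_simps[OF vec_A N]
      linear_on_simps[OF vec_B M] algebra_simps)

lemma swapped: "alia_actions t B brB s A brA lB rB lA rA"
  by (rule alia_actions.intro) (fact alia_A alia_B bil_lA bil_lB bil_rA bil_rB)+

end

text \<open>
  The construction is symmetric in \<open>A\<close> and \<open>B\<close>, so statements on the component in \<open>B\<close> are those on
  the component in \<open>A\<close> for the exchanged data.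
\<close>

lemma snd_alia_defect_bicross:
  "snd (alia_defect (bicross_bracket brA brB lA rA lB rB) (x, a) (y, b) (z, c)) =
   fst (alia_defect (bicross_bracket brB brA lB rB lA rA) (a, x) (b, y) (c, z))"
  by (simp add: alia_defect_def bicross_bracket_def)

lemma snd_nij_defect_bicross:
  "snd (nij_defect (bicross_bracket brA brB lA rA lB rB) (\<lambda>(x, f). (N x, M f)) (\<lambda>(x, f). (N x, M f)) (x, a) (y, b)) =
   fst (nij_defect (bicross_bracket brB brA lB rB lA rA) (\<lambda>(x, f). (M x, N f)) (\<lambda>(x, f). (M x, N f)) (a, x) (b, y))"
  by (simp add: nij_defect_def bicross_bracket_def)

context alia_actions
begin

interpretation swap: alia_actions t B brB s A brA lB rB lA rA
  by (rule swapped)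

lemma matched_pair_iff_defect:
  "matched_pair s A brA t B brB lA rA lB rB \<longleftrightarrow>
      (\<forall>x\<in>A. \<forall>y\<in>A. \<forall>a\<in>B. rep_defect brA lA rA x y a = 0) \<and>
      (\<forall>a\<in>B. \<forall>b\<in>B. \<forall>x\<in>A. rep_defect brB lB rB a b x = 0) \<and>
      (\<forall>x\<in>A. \<forall>y\<in>A. \<forall>a\<in>B. match_defect brA lA rA lB rB x y a = 0) \<and>
      (\<forall>x\<in>A. \<forall>a\<in>B. \<forall>b\<in>B. match_defect brB lB rB lA rA a b x = 0)"
  unfolding matched_pair_def alia_rep_iff_defect[OF vec_A vec_B bil_A bil_lA bil_rA]
    alia_rep_iff_defect[OF vec_B vec_A bil_B bil_lB bil_rB] match_defect_def
  using alia_A alia_B by simp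

text \<open>
  One direction is the expansion of the defect.  For the other, arguments with enough zero components
  isolate each of the four families of conditions.
\<close>

theorem left_alia_bracket_iff:
  "left_alia (prod_scale s t) (A \<times> B) bracket \<longleftrightarrow> matched_pair s A brA t B brB lA rA lB rB"
proof -
  note zs = match_defect_def rep_defect_def alia_defect_def linear_simps
  have alA: "alia_defect brA x y z = 0" if "x \<in> A" "y \<in> A" "z \<in> A" for x y z
    using alia_A left_alia_iff_defect[OF vec_A bil_A] that by blast
  have alB: "alia_defect brB x y z = 0" if "x \<in> B" "y \<in> B" "z \<in> B" for x y z
    using alia_B left_alia_iff_defect[OF vec_B bil_B] that by blast
  show ?thesis
    unfolding matched_pair_iff_defect left_alia_iff_defect[OF vec_space_on_prod[OF vec_A vec_B] bilinear_bracket]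
  proof (intro iffI conjI ballI)
    assume *: "\<forall>u\<in>A \<times> B. \<forall>v\<in>A \<times> B. \<forall>w\<in>A \<times> B. alia_defect bracket u v w = 0"
    have J: "fst (alia_defect bracket (x, a) (y, b) (z, c)) = 0"
      "fst (alia_defect swap.bracket (a, x) (b, y) (c, z)) = 0"
      if "x \<in> A" "y \<in> A" "z \<in> A" "a \<in> B" "b \<in> B" "c \<in> B" for x y z a b c
      using * that snd_alia_defect_bicross[of brA brB lA rA lB rB x a y b z c]
      by (metis (no_types, lifting) SigmaI fst_zero, metis (no_types, lifting) SigmaI snd_zero)
    have J1: "match_defect brA lA rA lB rB x y c + match_defect brA lA rA lB rB y z a
        + match_defect brA lA rA lB rB z x b
        + rep_defect brB lB rB a b z + rep_defect brB lB rB b c x + rep_defect brB lB rB c a y = 0"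
      if "x \<in> A" "y \<in> A" "z \<in> A" "a \<in> B" "b \<in> B" "c \<in> B" for x y z a b c
      using J(1)[OF that] fst_alia_defect_bracket[OF that] alA that by simp
    have J2: "match_defect brB lB rB lA rA a b z + match_defect brB lB rB lA rA b c x
        + match_defect brB lB rB lA rA c a y
        + rep_defect brA lA rA x y c + rep_defect brA lA rA y z a + rep_defect brA lA rA z x b = 0"
      if "x \<in> A" "y \<in> A" "z \<in> A" "a \<in> B" "b \<in> B" "c \<in> B" for x y z a b c
      using J(2)[OF that] swap.fst_alia_defect_bracket[of a b c x y z] alB that by simp
    show "rep_defect brA lA rA x y a = 0" if "x \<in> A" "y \<in> A" "a \<in> B" for x y a
      using J2[of x y 0 0 0 a] that by (simp add: zs)
    show "rep_defect brB lB rB a b x = 0" if "x \<in> A" "a \<in> B" "b \<in> B" for x a b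
      using J1[of 0 0 x a b 0] that by (simp add: zs)
    show "match_defect brA lA rA lB rB x y a = 0" if "x \<in> A" "y \<in> A" "a \<in> B" for x y a
      using J1[of x y 0 0 0 a] that by (simp add: zs)
    show "match_defect brB lB rB lA rA a b x = 0" if "x \<in> A" "a \<in> B" "b \<in> B" for x a b
      using J2[of 0 0 x a b 0] that by (simp add: zs)
  qed (auto simp: prod_eq_iff fst_alia_defect_bracket snd_alia_defect_bicross
      swap.fst_alia_defect_bracket alA alB)
qed

lemma nijenhuis_matched_pair_iff_defect:
  assumes "nijenhuis_left_alia s A brA N" and "nijenhuis_left_alia t B brB M"
  shows "nijenhuis_matched_pair s A brA N t B brB M lA rA lB rB \<longleftrightarrow>
    matched_pair s A brA t B brB lA rA lB rB \<and>
    (\<forall>x\<in>A. \<forall>b\<in>B. nij_defect lA N M x b = 0) \<and> (\<forall>x\<in>A. \<forall>b\<in>B. nij_defect rA N M x b = 0) \<and>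
    (\<forall>a\<in>B. \<forall>y\<in>A. nij_defect lB M N a y = 0) \<and> (\<forall>a\<in>B. \<forall>y\<in>A. nij_defect rB M N a y = 0)"
proof -
  have eq: "u + v - w - z = 0 \<longleftrightarrow> u + v = w + z" for u v w z :: "'c::ab_group_add"
    by (simp add: algebra_simps)
  have "linear_on s A s A N" "linear_on t B t B M"
    using assms by (simp_all add: nijenhuis_left_alia_def)
  with assms show ?thesis
    unfolding nijenhuis_matched_pair_def nijenhuis_rep_def matched_pair_def nij_defect_def eq
    by blast
qed

text \<open>
  The Nijenhuis defect of \<open>N + M\<close> at two elements of the sum is the sum of the defects of \<open>N\<close>, of
  \<open>M\<close>, and of the four actions.  At an element of \<open>A\<close> and one of \<open>B\<close> only two action defects remain,
  and they lie in different summands.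
\<close>

theorem nijenhuis_bracket_iff:
  assumes A: "nijenhuis_left_alia s A brA N" and B: "nijenhuis_left_alia t B brB M"
  shows "nijenhuis_left_alia (prod_scale s t) (A \<times> B) bracket (\<lambda>(x, f). (N x, M f)) \<longleftrightarrow>
    nijenhuis_matched_pair s A brA N t B brB M lA rA lB rB"
proof -
  let ?NM = "\<lambda>(x, f). (N x, M f)"
  have N: "linear_on s A s A N" and M: "linear_on t B t B M"
    using A B by (simp_all add: nijenhuis_left_alia_def)
  note NM = linear_on_simps[OF vec_A N] linear_on_simps[OF vec_B M]
  have lin: "linear_on (prod_scale s t) (A \<times> B) (prod_scale s t) (A \<times> B) ?NM"
    by (auto simp: linear_on_def prod_scale_def NM)
  have dA: "nij_defect brA N N x y = 0" if "x \<in> A" "y \<in> A" for x y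
    using A that nijenhuis_identity_iff_defect[OF vec_A bil_A N that]
    by (simp add: nijenhuis_left_alia_def)
  have dB: "nij_defect brB M M x y = 0" if "x \<in> B" "y \<in> B" for x y
    using B that nijenhuis_identity_iff_defect[OF vec_B bil_B M that]
    by (simp add: nijenhuis_left_alia_def)
  have defect: "nij_defect bracket ?NM ?NM (x, a) (y, b) =
      (nij_defect lB M N a y + nij_defect rB M N b x, nij_defect lA N M x b + nij_defect rA N M y a)"
    if "x \<in> A" "y \<in> A" "a \<in> B" "b \<in> B" for x y a b
    using that by (simp add: prod_eq_iff fst_nij_defect_bracket[OF N M] snd_nij_defect_bicross
        swap.fst_nij_defect_bracket[OF M N] dA dB)
  have zero: "nij_defect lB M N 0 y = 0" "nij_defect rB M N 0 y = 0"
    "nij_defect lA N M x 0 = 0" "nij_defect rA N M x 0 = 0"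
    "nij_defect lB M N b 0 = 0" "nij_defect rB M N b 0 = 0"
    "nij_defect lA N M 0 b = 0" "nij_defect rA N M 0 b = 0"
    if "x \<in> A" "y \<in> A" "b \<in> B" for x y b
    using that by (simp_all add: nij_defect_def linear_simps NM)
  have "(\<forall>u\<in>A \<times> B. \<forall>v\<in>A \<times> B. nij_defect bracket ?NM ?NM u v = 0) \<longleftrightarrow>
      (\<forall>x\<in>A. \<forall>b\<in>B. nij_defect lA N M x b = 0) \<and> (\<forall>x\<in>A. \<forall>b\<in>B. nij_defect rA N M x b = 0) \<and>
      (\<forall>a\<in>B. \<forall>y\<in>A. nij_defect lB M N a y = 0) \<and> (\<forall>a\<in>B. \<forall>y\<in>A. nij_defect rB M N a y = 0)"
    (is "?L \<longleftrightarrow> ?R")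
  proof
    assume *: ?L
    have d: "nij_defect bracket ?NM ?NM (x, a) (y, b) = 0"
      if "x \<in> A" "y \<in> A" "a \<in> B" "b \<in> B" for x y a b
      using * that by blast
    have "nij_defect lA N M x b = 0 \<and> nij_defect rB M N b x = 0" if "x \<in> A" "b \<in> B" for x b
      using d[of x 0 0 b] that by (simp add: defect linear_simps zero prod_eq_iff)
    moreover have "nij_defect lB M N a y = 0 \<and> nij_defect rA N M y a = 0" if "y \<in> A" "a \<in> B" for y a
      using d[of 0 y a 0] that by (simp add: defect linear_simps zero prod_eq_iff)
    ultimately show ?R by blast
  next
    assume ?R
    then show ?L by (auto simp: defect prod_eq_iff)
  qed
  then show ?thesis
    using nijenhuis_identity_iff_defect[OF vec_space_on_prod[OF vec_A vec_B] bilinear_bracket lin] lin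
    by (simp add: nijenhuis_left_alia_def left_alia_bracket_iff nijenhuis_matched_pair_iff_defect[OF A B])
qed

end

section \<open>Duality in finite dimension\<close>

context vector_space
begin

lemma dual_iff:
  "f \<in> dual scale \<longleftrightarrow> (\<forall>x y. f (x + y) = f x + f y) \<and> (\<forall>c x. f (scale c x) = c * f x)"
proof
  assume "f \<in> dual scale"
  then interpret f: Vector_Spaces.linear scale "(*)" f by (simp add: dual_def)
  show "(\<forall>x y. f (x + y) = f x + f y) \<and> (\<forall>c x. f (scale c x) = c * f x)"
    by (simp add: f.add f.scale)
next
  assume "(\<forall>x y. f (x + y) = f x + f y) \<and> (\<forall>c x. f (scale c x) = c * f x)"
  then show "f \<in> dual scale"
    unfolding dual_def by (auto, unfold_locales) (auto simp: algebra_simps)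
qed

lemma dual_simps:
  assumes "f \<in> dual scale"
  shows "f (x + y) = f x + f y" "f (x - y) = f x - f y" "f (- x) = - f x" "f 0 = 0"
    "f (scale c x) = c * f x" "f (\<Sum>i\<in>I. X i) = (\<Sum>i\<in>I. f (X i))"
proof -
  interpret f: Vector_Spaces.linear scale "(*)" f using assms by (simp add: dual_def)
  show "f (x + y) = f x + f y" "f (x - y) = f x - f y" "f (- x) = - f x" "f 0 = 0"
    "f (scale c x) = c * f x" "f (\<Sum>i\<in>I. X i) = (\<Sum>i\<in>I. f (X i))"
    by (rule f.add f.diff f.neg f.zero f.scale f.sum)+
qed

lemma vec_space_on_UNIV: "vec_space_on scale UNIV"
  by (simp add: vec_space_on_def vector_space_axioms)

lemma vec_space_on_dual: "vec_space_on fscale (dual scale)"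
proof -
  interpret F: vector_space "fscale :: 'a \<Rightarrow> ('b \<Rightarrow> 'a) \<Rightarrow> _" by (rule vector_space_fscale)
  have "F.subspace (dual scale)"
    by (rule F.subspaceI) (auto simp: dual_iff fscale_def algebra_simps)
  then show ?thesis by (simp add: vec_space_on_def F.vector_space_axioms)
qed

lemma dual_comp:
  assumes "f \<in> dual scale" and "linear_on scale UNIV scale UNIV h"
  shows "f \<circ> h \<in> dual scale"
  using assms by (auto simp: dual_iff linear_on_def)

end

context finite_dimensional_vector_space
begin

lemma dual_separates:
  assumes "\<And>f. f \<in> dual scale \<Longrightarrow> f x = f y"
  shows "x = y"
proof -
  have "(\<Sum>e\<in>Basis. coord e x *s e) = (\<Sum>e\<in>Basis. coord e y *s e)"
    by (intro sum.cong refl arg_cong[where f = "\<lambda>c. c *s _"] assms coord_dual)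
  then show ?thesis by (simp only: sum_coord)
qed

lemma eq_0_iff_dual: "x = 0 \<longleftrightarrow> (\<forall>f\<in>dual scale. f x = 0)"
  using dual_separates[of x 0] by (auto simp: dual_simps(4))

text \<open>
  In finite dimension every linear form \<open>\<Phi>\<close> on the dual is evaluation at a vector, namely at
  \<open>\<Sum> \<Phi>(e\<^sup>*) e\<close> over the basis with coordinate functionals \<open>e\<^sup>*\<close>.  Since functionals separate
  vectors, \<open>undouble\<close> returns that vector.
\<close>

lemma undouble_pairing:
  assumes \<Phi>: "linear_on fscale (dual scale) (*) UNIV \<Phi>" and f: "f \<in> dual scale"
  shows "f (undouble scale \<Phi>) = \<Phi> f"
proof -
  note D = vec_space_on_closed[OF vec_space_on_dual] and L = linear_on_simps[OF vec_space_on_dual \<Phi>]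
  define x where "x = (\<Sum>e\<in>Basis. \<Phi> (coord e) *s e)"
  have sum_dual: "(\<Sum>e\<in>I. fscale (c e) (coord e)) \<in> dual scale" for I and c :: "'b \<Rightarrow> 'a"
    by (induction I rule: infinite_finite_induct)
      (simp_all only: sum.infinite sum.empty sum.insert D coord_dual if_True not_False_eq_True)
  have sum_\<Phi>: "\<Phi> (\<Sum>e\<in>I. fscale (c e) (coord e)) = (\<Sum>e\<in>I. c e * \<Phi> (coord e))" for I and c :: "'b \<Rightarrow> 'a"
    by (induction I rule: infinite_finite_induct)
      (simp_all only: sum.infinite sum.empty sum.insert L D coord_dual sum_dual not_False_eq_True)
  have sum_apply: "(\<Sum>e\<in>I. h e) v = (\<Sum>e\<in>I. h e v)" for I v and h :: "'b \<Rightarrow> 'b \<Rightarrow> 'a"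
    by (induction I rule: infinite_finite_induct) simp_all
  have x: "g x = \<Phi> g" if g: "g \<in> dual scale" for g
  proof -
    have "g v = (\<Sum>e\<in>Basis. fscale (g e) (coord e)) v" for v
    proof -
      have "g v = g (\<Sum>e\<in>Basis. coord e v *s e)" by (simp add: sum_coord)
      also have "\<dots> = (\<Sum>e\<in>Basis. g e * coord e v)" by (simp add: dual_simps[OF g] mult.commute)
      finally show ?thesis
        by (simp add: fscale_def sum_apply)
    qed
    then have "g = (\<Sum>e\<in>Basis. fscale (g e) (coord e))" by blast
    then have "\<Phi> g = (\<Sum>e\<in>Basis. g e * \<Phi> (coord e))" using sum_\<Phi>[of g Basis] by metis
    then show ?thesis by (simp add: x_def dual_simps[OF g] mult.commute)
  qed
  have "undouble scale \<Phi> = x"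
    unfolding undouble_def by (rule the_equality) (auto simp: x intro: dual_separates)
  then show ?thesis by (simp add: x f)
qed

lemma bilinear_on_dual_rep:
  assumes "bilinear_on scale UNIV scale UNIV scale UNIV \<rho>"
  shows "bilinear_on scale UNIV fscale (dual scale) fscale (dual scale) (dual_rep \<rho>)"
proof -
  note \<rho> = bilinear_on_simps[OF vec_space_on_UNIV vec_space_on_UNIV assms, simplified]
  have "dual_rep \<rho> x f \<in> dual scale" if "f \<in> dual scale" for x f
    using that by (simp add: dual_iff dual_rep_def \<rho>)
  moreover have "dual_rep \<rho> (x + y) f = dual_rep \<rho> x f + dual_rep \<rho> y f"
    "dual_rep \<rho> (c *s x) f = fscale c (dual_rep \<rho> x f)" if "f \<in> dual scale" for x y c f
    using dual_simps[OF that] by (simp_all add: dual_rep_def fun_eq_iff fscale_def \<rho>)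
  ultimately show ?thesis
    by (auto simp: bilinear_on_def linear_on_def) (auto simp: dual_rep_def fscale_def)
qed

text \<open>
  This formula replaces the definition by \<open>undouble\<close>: an action on the base space is only ever used
  through its pairings with functionals.
\<close>

lemma dual_rep_on_base_pairing:
  assumes "bilinear_on fscale (dual scale) fscale (dual scale) fscale (dual scale) \<rho>"
    and f: "f \<in> dual scale" and g: "g \<in> dual scale"
  shows "g (dual_rep_on_base scale \<rho> f x) = - \<rho> f g x"
proof -
  note \<rho> = bilinear_on_simps[OF vec_space_on_dual vec_space_on_dual assms(1)]
  have "\<rho> f (fscale c h) x = c * \<rho> f h x" if "h \<in> dual scale" for h c
    using \<rho>(8)[OF f that, of c] by (simp add: fscale_def)
  then have "linear_on fscale (dual scale) (*) UNIV (dual_rep \<rho> f (\<lambda>h. h x))"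
    using f by (simp add: linear_on_def dual_rep_def \<rho>)
  from undouble_pairing[OF this g] show ?thesis
    unfolding dual_rep_on_base_def by (simp add: dual_rep_def)
qed

lemma bilinear_on_dual_rep_on_base:
  assumes "bilinear_on fscale (dual scale) fscale (dual scale) fscale (dual scale) \<rho>"
  shows "bilinear_on fscale (dual scale) scale UNIV scale UNIV (dual_rep_on_base scale \<rho>)"
proof -
  note \<rho> = bilinear_on_simps[OF vec_space_on_dual vec_space_on_dual assms]
  note pair = dual_rep_on_base_pairing[OF assms]
  note D = vec_space_on_closed[OF vec_space_on_dual]
  let ?b = "dual_rep_on_base scale \<rho>"
  have "?b (f + g) x = ?b f x + ?b g x" "?b (fscale c f) x = c *s ?b f x"
    "?b f (x + y) = ?b f x + ?b f y" "?b f (c *s x) = c *s ?b f x"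
    if fg: "f \<in> dual scale" "g \<in> dual scale" for f g x y c
  proof (rule_tac [!] dual_separates)
    fix h assume h: "h \<in> dual scale"
    note hs = dual_simps[OF h] dual_simps[OF \<rho>(1)[OF fg(1) h]]
    show "h (?b (f + g) x) = h (?b f x + ?b g x)"
      using fg h by (simp add: hs pair \<rho> D del: plus_fun_apply) simp
    show "h (?b (fscale c f) x) = h (c *s ?b f x)"
      using fg h by (simp add: hs pair \<rho> D) (simp add: fscale_def)
    show "h (?b f (x + y)) = h (?b f x + ?b f y)" "h (?b f (c *s x)) = h (c *s ?b f x)"
      using fg h by (simp_all add: hs pair)
  qed
  then show ?thesis
    by (auto simp: bilinear_on_def linear_on_def)
qed

end

section \<open>A left Alia algebra and a left Alia structure on its dual\<close>

locale alia_dual_pair = finite_dimensional_vector_space scale Basis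
  for scale :: "'k::field \<Rightarrow> 'a::ab_group_add \<Rightarrow> 'a" (infixr "*s" 75) and Basis +
  fixes br :: "'a \<Rightarrow> 'a \<Rightarrow> 'a" and brd :: "('a \<Rightarrow> 'k) \<Rightarrow> ('a \<Rightarrow> 'k) \<Rightarrow> ('a \<Rightarrow> 'k)"
  assumes alia: "left_alia scale UNIV br" and alia_dual: "left_alia fscale (dual scale) brd"
begin

abbreviation "lA \<equiv> dual_rep (Lop br) :: 'a \<Rightarrow> ('a \<Rightarrow> 'k) \<Rightarrow> 'a \<Rightarrow> 'k"
abbreviation "rA \<equiv> \<lambda>x f. dual_rep (Lop br) x f - dual_rep (Rop br) x f :: 'a \<Rightarrow> 'k"
abbreviation "lB \<equiv> dual_rep_on_base scale (Lop brd)"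
abbreviation "rB \<equiv> \<lambda>f x. dual_rep_on_base scale (Lop brd) f x - dual_rep_on_base scale (Rop brd) f x"

lemma bilinear_br: "bilinear_on scale UNIV scale UNIV scale UNIV br"
  and bilinear_brd: "bilinear_on fscale (dual scale) fscale (dual scale) fscale (dual scale) brd"
  using alia alia_dual by (simp_all add: left_alia_def)

lemmas br_simps = bilinear_on_simps[OF vec_space_on_UNIV vec_space_on_UNIV bilinear_br, simplified]
lemmas brd_simps = bilinear_on_simps[OF vec_space_on_dual vec_space_on_dual bilinear_brd]
lemmas dual_closed = vec_space_on_closed[OF vec_space_on_dual]

lemma brd_neg: "f \<in> dual scale \<Longrightarrow> g \<in> dual scale \<Longrightarrow> brd (- f) g = - brd f g"
  using brd_simps(3)[of 0 f g] dual_closed(1) by (simp add: brd_simps)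

lemma bilinear_ops:
  "bilinear_on scale UNIV scale UNIV scale UNIV (Lop br)"
  "bilinear_on scale UNIV scale UNIV scale UNIV (Rop br)"
  "bilinear_on fscale (dual scale) fscale (dual scale) fscale (dual scale) (Lop brd)"
  "bilinear_on fscale (dual scale) fscale (dual scale) fscale (dual scale) (Rop brd)"
  using bilinear_br bilinear_brd unfolding bilinear_on_def Lop_def Rop_def by auto

lemma lA_apply: "lA x f v = - f (br x v)"
  and rA_apply: "rA x f v = f (br v x) - f (br x v)"
  by (simp_all add: dual_rep_def Lop_def Rop_def)

lemma dual_br: "f \<in> dual scale \<Longrightarrow> (\<lambda>v. f (br v x)) \<in> dual scale"
  by (simp add: dual_iff br_simps)

lemma lB_pairing: "f \<in> dual scale \<Longrightarrow> g \<in> dual scale \<Longrightarrow> g (lB f x) = - brd f g x"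
  using dual_rep_on_base_pairing[OF bilinear_ops(3)] by (simp add: Lop_def)

lemma base_R_pairing:
  "f \<in> dual scale \<Longrightarrow> g \<in> dual scale \<Longrightarrow> g (dual_rep_on_base scale (Rop brd) f x) = - brd g f x"
  using dual_rep_on_base_pairing[OF bilinear_ops(4)] by (simp add: Rop_def)

lemma rB_pairing: "f \<in> dual scale \<Longrightarrow> g \<in> dual scale \<Longrightarrow> g (rB f x) = brd g f x - brd f g x"
  by (simp add: dual_simps lB_pairing base_R_pairing)

sublocale alia_actions scale UNIV br fscale "dual scale" brd lA rA lB rB
  by (intro alia_actions.intro alia alia_dual bilinear_on_dual_rep bilinear_on_dual_rep_on_base
      bilinear_on_diff[OF vec_space_on_UNIV] bilinear_on_diff[OF vec_space_on_dual] bilinear_ops)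

section \<open>Matched pair conditions as scalar identities\<close>

text \<open>
  The actions \<open>\<L>\<^sup>*\<close> and \<open>\<L>\<^sup>* - \<R>\<^sup>*\<close> of \<open>A\<close> on its dual always form a representation: evaluated at
  \<open>v\<close>, the representation condition is a functional applied to the Alia identity of \<open>x\<close>, \<open>y\<close>, \<open>v\<close>.
  The same holds for the actions of the dual on \<open>A\<close>, proved below as \<open>rep_defect_B\<close>.
\<close>

lemma rep_defect_A: "f \<in> dual scale \<Longrightarrow> rep_defect br lA rA x y f = 0"
proof
  fix v assume f: "f \<in> dual scale"
  have "alia_defect br x y v = 0"
    using alia left_alia_iff_defect[OF vec_A bil_A] by simp
  then have "f (alia_defect br x y v) = 0" by (simp add: dual_simps[OF f])
  then show "rep_defect br lA rA x y f v = 0 v"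
    by (simp add: rep_defect_def alia_defect_def dual_rep_def Lop_def Rop_def br_simps
        dual_simps[OF f] algebra_simps)
qed

text \<open>
  The form whose vanishing expresses all mixed identities.  It equals
  \<open>\<B>(J(x, y, f), g)\<close>, with \<open>J\<close> the Alia defect of the bracket on \<open>A \<oplus> A\<^sup>*\<close>.  Invariance of \<open>\<B>\<close> gives
  \<open>\<B>(J(u, v, w), z) = \<B>({u, v}, {z, w}) + \<B>({v, w}, {z, u}) + \<B>({w, u}, {z, v})\<close>, which changes sign
  when any two arguments are exchanged.  This is why the two matched pair equations, which read off
  \<open>J(x, y, f)\<close> in \<open>A\<close> and \<open>J(f, g, x)\<close> in \<open>A\<^sup>*\<close>, are equivalent.
\<close>

definition match_form :: "'a \<Rightarrow> 'a \<Rightarrow> ('a \<Rightarrow> 'k) \<Rightarrow> ('a \<Rightarrow> 'k) \<Rightarrow> 'k" where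
  "match_form x y f g = (brd g f - brd f g) (br x y - br y x)
     - (brd (\<lambda>v. g (br v y)) f x - brd (\<lambda>v. f (br v y)) g x
        - brd (\<lambda>v. g (br v x)) f y + brd (\<lambda>v. f (br v x)) g y)"

lemma lB_rB_diff_pairing: "f \<in> dual scale \<Longrightarrow> g \<in> dual scale \<Longrightarrow> g (lB f x - rB f x) = - brd g f x"
   "f \<in> dual scale \<Longrightarrow> g \<in> dual scale \<Longrightarrow> g (rB f x - lB f x) = brd g f x"
  by (simp_all add: dual_simps(3) base_R_pairing)

lemma rA_lA_diff: "rA x f - lA x f = (\<lambda>v. f (br v x))" "lA x f - rA x f = - (\<lambda>v. f (br v x))"
  by (simp_all add: fun_eq_iff dual_rep_def Rop_def)

lemma pairing_match_defect_A:
  assumes f: "f \<in> dual scale" and g: "g \<in> dual scale"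
  shows "g (match_defect br lA rA lB rB x y f) = match_form x y f g"
proof -
  have d: "g (lB f w) = - brd f g w" "g (dual_rep_on_base scale (Rop brd) f w) = - brd g f w"
    "g (br (lB f y - rB f y) x) = - brd (\<lambda>v. g (br v x)) f y"
    "g (br (rB f x - lB f x) y) = brd (\<lambda>v. g (br v y)) f x"
    "g (lB (rA y f - lA y f) x) = - brd (\<lambda>v. f (br v y)) g x"
    "g (lB (lA x f - rA x f) y) = brd (\<lambda>v. f (br v x)) g y" for w
    using lB_pairing[OF f g] base_R_pairing[OF f g] lB_rB_diff_pairing[OF f dual_br[OF g]] lB_pairing[OF dual_br[OF f] g]
      lB_pairing[OF dual_closed(4)[OF dual_br[OF f]] g] brd_neg[OF dual_br[OF f] g]
    by (simp_all only: rA_lA_diff) simp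
  show ?thesis
    unfolding match_defect_def match_form_def
    by (simp only: dual_simps[OF g] d) simp
qed

lemma match_defect_B_apply:
  assumes f: "f \<in> dual scale" and g: "g \<in> dual scale"
  shows "match_defect brd lB rB lA rA f g x y = match_form x y f g"
proof -
  have d: "rA x (brd f g - brd g f) y = (brd g f - brd f g) (br x y - br y x)"
    "brd (lA x g - rA x g) f y = - brd (\<lambda>v. g (br v x)) f y"
    "brd (rA x f - lA x f) g y = brd (\<lambda>v. f (br v x)) g y"
    "lA (rB g x - lB g x) f y = - brd (\<lambda>v. f (br v y)) g x"
    "lA (lB f x - rB f x) g y = brd (\<lambda>v. g (br v y)) f x"
    subgoal
      by (subst rA_apply)
        (simp add: dual_simps(2)[OF brd_simps(1)[OF f g]] dual_simps(2)[OF brd_simps(1)[OF g f]])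
    using lB_rB_diff_pairing[OF f dual_br[OF g]] lB_rB_diff_pairing[OF g dual_br[OF f]] brd_neg[OF dual_br[OF g] f]
    by (simp_all only: rA_lA_diff lA_apply) (simp_all add: rA_lA_diff)
  show ?thesis
    unfolding match_defect_def match_form_def
    by (subst minus_apply, simp only: plus_fun_apply d) simp
qed

lemma rep_defect_B:
  assumes f: "f \<in> dual scale" and g: "g \<in> dual scale"
  shows "rep_defect brd lB rB f g x = 0"
proof (rule dual_separates)
  fix h assume h: "h \<in> dual scale"
  have "alia_defect brd f g h = 0"
    using alia_dual left_alia_iff_defect[OF vec_B bil_B] f g h by simp
  then have a: "alia_defect brd f g h x = 0" by simp
  have k: "h (rB f w) = (brd h f - brd f h) w" "h (rB g w) = (brd h g - brd g h) w" for w
    using rB_pairing f g h by simp_all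
  have kd: "brd h f - brd f h \<in> dual scale" "brd h g - brd g h \<in> dual scale" "brd f g - brd g f \<in> dual scale"
    by (intro dual_closed(3) brd_simps(1) f g h)+
  have "h (rep_defect brd lB rB f g x) =
      h (lB (brd f g - brd g f) x) - h (rB f (rB g x - lB g x)) + h (rB g (rB f x - lB f x))"
    unfolding rep_defect_def by (subst dual_simps(1)[OF h], subst dual_simps(2)[OF h], rule refl)
  also have "\<dots> =
    - brd (brd f g - brd g f) h x - brd (brd h f - brd f h) g x + brd (brd h g - brd g h) f x"
    by (simp only: k lB_pairing[OF kd(3) h] lB_rB_diff_pairing(2)[OF f kd(2)] lB_rB_diff_pairing(2)[OF g kd(1)])
  also have "\<dots> = - alia_defect brd f g h x"
    using f g h by (simp add: alia_defect_def brd_simps)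
  finally show "h (rep_defect brd lB rB f g x) = h 0" by (simp add: a dual_simps[OF h])
qed

text \<open>
  Functionals separate vectors and vectors separate functionals, so both matched pair equations become
  the vanishing of \<open>match_form\<close>.
\<close>

theorem matched_pair_iff_match_form:
  "matched_pair scale UNIV br fscale (dual scale) brd lA rA lB rB \<longleftrightarrow>
    (\<forall>x y. \<forall>f\<in>dual scale. \<forall>g\<in>dual scale. match_form x y f g = 0)"
proof -
  have A: "(\<forall>f\<in>dual scale. match_defect br lA rA lB rB x y f = 0) \<longleftrightarrow>
    (\<forall>f\<in>dual scale. \<forall>g\<in>dual scale. match_form x y f g = 0)" for x y
    by (simp add: eq_0_iff_dual pairing_match_defect_A)
  have B: "(\<forall>f\<in>dual scale. \<forall>g\<in>dual scale. match_defect brd lB rB lA rA f g x = 0) \<longleftrightarrow>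
    (\<forall>y. \<forall>f\<in>dual scale. \<forall>g\<in>dual scale. match_form x y f g = 0)" for x
    by (auto simp: fun_eq_iff match_defect_B_apply)
  have "matched_pair scale UNIV br fscale (dual scale) brd lA rA lB rB \<longleftrightarrow>
      (\<forall>x y. \<forall>f\<in>dual scale. match_defect br lA rA lB rB x y f = 0) \<and>
      (\<forall>x. \<forall>f\<in>dual scale. \<forall>g\<in>dual scale. match_defect brd lB rB lA rA f g x = 0)"
    unfolding matched_pair_iff_defect using rep_defect_A rep_defect_B by blast
  then show ?thesis unfolding A B by blast
qed

end

section \<open>Manin triples\<close>

lemma nijenhuis_left_alia_cong:
  assumes "nijenhuis_left_alia s V b N" and "\<And>u v. u \<in> V \<Longrightarrow> v \<in> V \<Longrightarrow> b u v = b' u v"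
  shows "nijenhuis_left_alia s V b' N"
proof -
  have closed: "b u v \<in> V" "N u \<in> V" if "u \<in> V" "v \<in> V" for u v
    using assms(1) that
    by (simp_all add: nijenhuis_left_alia_def left_alia_def bilinear_on_def linear_on_def)
  have V: "u + v \<in> V" "s c u \<in> V" if "u \<in> V" "v \<in> V" for u v c
    using vec_space_on_closed[of s V] assms(1) that
    by (simp_all add: nijenhuis_left_alia_def left_alia_def)
  show ?thesis
    using assms(1) closed V
    by (simp add: nijenhuis_left_alia_def left_alia_def bilinear_on_def linear_on_def assms(2)[symmetric])
      (elim conjE, assumption)
qed

context alia_dual_pair
begin

text \<open>
  The pairing is nondegenerate, and invariance moves a mixed product onto products inside \<open>A\<close> or
  inside \<open>A\<^sup>*\<close>.  The components of \<open>[x, f]\<close> and \<open>[f, x]\<close> are therefore determined, and come out as the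
  coadjoint actions.
\<close>

lemma invariant_bracket_unique:
  assumes bil: "bilinear_on (prod_scale scale fscale) (UNIV \<times> dual scale)
      (prod_scale scale fscale) (UNIV \<times> dual scale) (prod_scale scale fscale) (UNIV \<times> dual scale) BR"
    and A: "\<And>x y. BR (x, 0) (y, 0) = (br x y, 0)"
    and B: "\<And>f g. f \<in> dual scale \<Longrightarrow> g \<in> dual scale \<Longrightarrow> BR (0, f) (0, g) = (0, brd f g)"
    and inv: "\<And>u v w. u \<in> UNIV \<times> dual scale \<Longrightarrow> v \<in> UNIV \<times> dual scale \<Longrightarrow> w \<in> UNIV \<times> dual scale \<Longrightarrow>
      pairing_form (BR u v) w = pairing_form u (BR w v - BR v w)"
    and a: "a \<in> dual scale" and b: "b \<in> dual scale"
  shows "BR (x, a) (y, b) = bracket (x, a) (y, b)"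
proof -
  note V = vec_space_on_prod[OF vec_space_on_UNIV vec_space_on_dual]
  note BR = bilinear_on_simps[OF V V bil]
  have inv': "pairing_form (BR (x, f) (y, g)) (z, h) =
      pairing_form (x, f) (BR (z, h) (y, g) - BR (y, g) (z, h))"
    if "f \<in> dual scale" "g \<in> dual scale" "h \<in> dual scale" for x y z f g h
    using inv that by blast
  have snd_0: "snd (BR (x, f) (y, g)) 0 = 0" if "f \<in> dual scale" "g \<in> dual scale" for x y f g
  proof -
    have "BR (x, f) (y, g) \<in> UNIV \<times> dual scale" using BR(1) that by blast
    then have "snd (BR (x, f) (y, g)) \<in> dual scale" by (simp add: mem_Times_iff)
    then show ?thesis by (rule dual_simps(4))
  qed
  have AB: "BR (x, 0) (0, f) = (rB f x, lA x f)" if f: "f \<in> dual scale" for x f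
  proof (rule prod_eqI)
    show "fst (BR (x, 0) (0, f)) = fst (rB f x, lA x f)"
    proof (rule dual_separates)
      fix g assume g: "g \<in> dual scale"
      show "g (fst (BR (x, 0) (0, f))) = g (fst (rB f x, lA x f))"
        using inv'[of 0 f g x 0 0] rB_pairing[OF f g, of x] f g dual_closed(1)
        by (simp add: pairing_form_def B snd_0 dual_simps(4)[OF g])
    qed
    show "snd (BR (x, 0) (0, f)) = snd (rB f x, lA x f)"
    proof
      fix y
      show "snd (BR (x, 0) (0, f)) y = snd (rB f x, lA x f) y"
        \<comment> \<open>The right-hand sides of the two instances are opposite, so \<open>\<B>([x, f], y) = - \<B>([x, y], f)\<close>.\<close>
        using inv'[of 0 f 0 x 0 y] inv'[of 0 0 f x y 0] f dual_closed(1)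
        by (simp add: pairing_form_def A lA_apply dual_simps(4)[OF f])
    qed
  qed
  have BA: "BR (0, f) (x, 0) = (lB f x, rA x f)" if f: "f \<in> dual scale" for x f
  proof (rule prod_eqI)
    show "fst (BR (0, f) (x, 0)) = fst (lB f x, rA x f)"
    proof (rule dual_separates)
      fix g assume g: "g \<in> dual scale"
      show "g (fst (BR (0, f) (x, 0))) = g (fst (lB f x, rA x f))"
        \<comment> \<open>Likewise \<open>\<B>([f, x], g) = - \<B>([f, g], x)\<close>.\<close>
        using inv'[of f 0 g 0 x 0] inv'[of f g 0 0 0 x] f g dual_closed(1)
        by (simp add: pairing_form_def B snd_0 lB_pairing dual_simps[OF f])
    qed
    show "snd (BR (0, f) (x, 0)) = snd (lB f x, rA x f)"
    proof
      fix y
      show "snd (BR (0, f) (x, 0)) y = snd (lB f x, rA x f) y"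
        using inv'[of f 0 0 0 x y] f dual_closed(1) rA_apply[of x f y]
        by (simp add: pairing_form_def A dual_simps[OF f])
    qed
  qed
  have "BR (x, a) (y, b) = BR ((x, 0) + (0, a)) ((y, 0) + (0, b))" by simp
  also have "\<dots> = BR (x, 0) (y, 0) + BR (x, 0) (0, b) + (BR (0, a) (y, 0) + BR (0, a) (0, b))"
  proof -
    have c: "(x, 0) \<in> UNIV \<times> dual scale" "(0, a) \<in> UNIV \<times> dual scale"
      "(y, 0) \<in> UNIV \<times> dual scale" "(0, b) \<in> UNIV \<times> dual scale"
      by (simp_all add: a b dual_closed(1))
    show ?thesis
      unfolding BR(2)[OF c(1,2) vec_space_on_closed(2)[OF V c(3,4)]] BR(6)[OF c(1,3,4)] BR(6)[OF c(2,3,4)]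
      by (rule refl)
  qed
  also have "\<dots> = bracket (x, a) (y, b)"
    by (simp only: A B[OF a b] AB[OF b] BA[OF a]) (simp add: bicross_bracket_def algebra_simps)
  finally show ?thesis .
qed

lemma bracket_invariant:
  assumes "a \<in> dual scale" "b \<in> dual scale" "c \<in> dual scale"
  shows "pairing_form (bracket (x, a) (y, b)) (z, c) =
    pairing_form (x, a) (bracket (z, c) (y, b) - bracket (y, b) (z, c))"
  using assms
  by (simp add: pairing_form_def bicross_bracket_def dual_simps[OF assms(1)] dual_simps[OF assms(2)]
      dual_simps[OF assms(3)] lB_pairing base_R_pairing)
    (simp add: dual_rep_def Lop_def Rop_def)

text \<open>
  By uniqueness a Manin triple exists if and only if the bracket built from the coadjoint actions is
  a Nijenhuis left Alia structure; its invariance is automatic.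
\<close>

theorem manin_triple_iff:
  assumes A: "nijenhuis_left_alia scale UNIV br N" and B: "nijenhuis_left_alia fscale (dual scale) brd M"
  shows "(\<exists>BR. nijenhuis_manin_triple scale br N brd M BR) \<longleftrightarrow>
    nijenhuis_matched_pair scale UNIV br N fscale (dual scale) brd M lA rA lB rB"
  unfolding nijenhuis_bracket_iff[OF A B, symmetric]
proof
  assume "\<exists>BR. nijenhuis_manin_triple scale br N brd M BR"
  then obtain BR where BR: "nijenhuis_manin_triple scale br N brd M BR" ..
  have "BR (x, a) (y, b) = bracket (x, a) (y, b)" if "a \<in> dual scale" "b \<in> dual scale" for x y a b
    using BR that
    by (intro invariant_bracket_unique)
      (auto simp: nijenhuis_manin_triple_def nijenhuis_left_alia_def left_alia_def)
  then have "BR u v = bracket u v" if "u \<in> UNIV \<times> dual scale" "v \<in> UNIV \<times> dual scale" for u v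
    using that by (cases u, cases v) (simp only: mem_Sigma_iff)
  moreover have "nijenhuis_left_alia (prod_scale scale fscale) (UNIV \<times> dual scale) BR
      (\<lambda>(x, f). (N x, M f))"
    using BR by (simp only: nijenhuis_manin_triple_def)
  ultimately show "nijenhuis_left_alia (prod_scale scale fscale) (UNIV \<times> dual scale) bracket
      (\<lambda>(x, f). (N x, M f))"
    by (rule nijenhuis_left_alia_cong[rotated])
next
  assume "nijenhuis_left_alia (prod_scale scale fscale) (UNIV \<times> dual scale) bracket
      (\<lambda>(x, f). (N x, M f))"
  moreover have "bracket (x, 0) (y, 0) = (br x y, 0)" for x y
    by (rule bracket_on_A) simp_all
  moreover have "bracket (0, f) (0, g) = (0, brd f g)" if "f \<in> dual scale" "g \<in> dual scale" for f g
    using that by (rule bracket_on_B)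
  moreover have "pairing_form (bracket u v) w = pairing_form u (bracket w v - bracket v w)"
    if "u \<in> UNIV \<times> dual scale" "v \<in> UNIV \<times> dual scale" "w \<in> UNIV \<times> dual scale" for u v w
    using that by (cases u, cases v, cases w) (simp only: mem_Sigma_iff bracket_invariant)
  ultimately have "nijenhuis_manin_triple scale br N brd M bracket"
    unfolding nijenhuis_manin_triple_def using A B by blast
  then show "\<exists>BR. nijenhuis_manin_triple scale br N brd M BR"
    by (rule exI[of _ bracket])
qed

section \<open>Nijenhuis conditions as scalar identities\<close>

text \<open>
  For an action on the dual the condition on a Nijenhuis representation transposes to an identity in
  \<open>A\<close> alone, in which \<open>S\<close> stands in the place of \<open>S\<^sup>*\<close>.
\<close>

lemma nij_defect_dual_rep_iff:
  assumes S: "linear_on scale UNIV scale UNIV S"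
  shows "(\<forall>f\<in>dual scale. nij_defect (dual_rep \<rho>) N (transpose_map S) x f = 0) \<longleftrightarrow>
    (\<forall>y. S (\<rho> (N x) y) + \<rho> x (S (S y)) = S (\<rho> x (S y)) + \<rho> (N x) (S y))"
proof -
  have "nij_defect (dual_rep \<rho>) N (transpose_map S) x f y =
      - f (S (\<rho> (N x) y) + \<rho> x (S (S y)) - (S (\<rho> x (S y)) + \<rho> (N x) (S y)))"
    if f: "f \<in> dual scale" for f y
    by (simp add: nij_defect_def dual_rep_def transpose_map_def dual_simps[OF f])
  then have "(\<forall>f\<in>dual scale. nij_defect (dual_rep \<rho>) N (transpose_map S) x f = 0) \<longleftrightarrow>
      (\<forall>y. S (\<rho> (N x) y) + \<rho> x (S (S y)) - (S (\<rho> x (S y)) + \<rho> (N x) (S y)) = 0)"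
    unfolding fun_eq_iff eq_0_iff_dual by (auto simp del: right_minus_eq)
  then show ?thesis by simp
qed

text \<open>
  Dually, for an action on \<open>A\<close> the condition is an identity between products of functionals; for the
  dual of a comultiplication it is the value of a tensor identity at a pair of functionals.
\<close>

lemma nij_defect_dual_rep_on_base_iff:
  assumes \<rho>: "bilinear_on fscale (dual scale) fscale (dual scale) fscale (dual scale) \<rho>"
    and N: "linear_on scale UNIV scale UNIV N" and S: "linear_on scale UNIV scale UNIV S"
    and f: "f \<in> dual scale"
  shows "(\<forall>x. nij_defect (dual_rep_on_base scale \<rho>) (transpose_map S) N f x = 0) \<longleftrightarrow>
    (\<forall>x. \<forall>g\<in>dual scale. \<rho> (f \<circ> S) g (N x) + \<rho> f (g \<circ> (N \<circ> N)) x =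
      \<rho> (f \<circ> S) (g \<circ> N) x + \<rho> f (g \<circ> N) (N x))"
proof -
  have *: "g (nij_defect (dual_rep_on_base scale \<rho>) (transpose_map S) N f x) =
      \<rho> (f \<circ> S) (g \<circ> N) x + \<rho> f (g \<circ> N) (N x) - (\<rho> (f \<circ> S) g (N x) + \<rho> f (g \<circ> (N \<circ> N)) x)"
    if g: "g \<in> dual scale" for g x
  proof -
    note gN = dual_comp[OF g N] dual_comp[OF dual_comp[OF g N] N]
    note fS = dual_comp[OF f S]
    note p = dual_rep_on_base_pairing[OF \<rho>]
    show ?thesis
      using p[OF fS g] p[OF f gN(2)] p[OF fS gN(1)] p[OF f gN(1)]
      by (simp add: nij_defect_def transpose_map_def dual_simps[OF g] comp_assoc)
  qed
  have "g (nij_defect (dual_rep_on_base scale \<rho>) (transpose_map S) N f x) = 0 \<longleftrightarrow>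
      \<rho> (f \<circ> S) g (N x) + \<rho> f (g \<circ> (N \<circ> N)) x = \<rho> (f \<circ> S) (g \<circ> N) x + \<rho> f (g \<circ> N) (N x)"
    if "g \<in> dual scale" for g x
    unfolding *[OF that] right_minus_eq by (rule eq_commute)
  then show ?thesis
    unfolding eq_0_iff_dual by blast
qed

text \<open>
  The second action in each pair is a difference of the duals of left and right multiplication.  The
  Nijenhuis defect is additive in the action, so the conditions for \<open>l\<close> and \<open>l - r\<close> are those for
  \<open>l\<close> and \<open>r\<close>, and right multiplication can be treated on its own.
\<close>

theorem nijenhuis_matched_pair_iff:
  assumes A: "nijenhuis_left_alia scale UNIV br N" and S: "linear_on scale UNIV scale UNIV S"
    and B: "nijenhuis_left_alia fscale (dual scale) brd (transpose_map S)"
  shows "nijenhuis_matched_pair scale UNIV br N fscale (dual scale) brd (transpose_map S) lA rA lB rB \<longleftrightarrow>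
    (\<forall>x y. \<forall>f\<in>dual scale. \<forall>g\<in>dual scale. match_form x y f g = 0) \<and>
    (\<forall>x y. S (br (N x) y) + br x (S (S y)) = S (br x (S y)) + br (N x) (S y)) \<and>
    (\<forall>x y. S (br x (N y)) + br (S (S x)) y = S (br (S x) y) + br (S x) (N y)) \<and>
    (\<forall>x. \<forall>f\<in>dual scale. \<forall>g\<in>dual scale.
      brd (f \<circ> S) g (N x) + brd f (g \<circ> (N \<circ> N)) x = brd (f \<circ> S) (g \<circ> N) x + brd f (g \<circ> N) (N x)) \<and>
    (\<forall>x. \<forall>f\<in>dual scale. \<forall>g\<in>dual scale.
      brd f (g \<circ> S) (N x) + brd (f \<circ> (N \<circ> N)) g x = brd (f \<circ> N) (g \<circ> S) x + brd (f \<circ> N) g (N x))"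
proof -
  have N: "linear_on scale UNIV scale UNIV N" using A by (simp add: nijenhuis_left_alia_def)
  note Ns = linear_on_simps[OF vec_space_on_UNIV N, simplified]
  let ?S = "transpose_map S :: ('a \<Rightarrow> 'k) \<Rightarrow> _"
  have rA: "nij_defect rA N ?S x f =
      nij_defect lA N ?S x f - nij_defect (dual_rep (Rop br)) N ?S x f" for x f
    by (simp add: nij_defect_def fun_eq_iff transpose_map_def)
  have rB: "nij_defect rB ?S N f x =
      nij_defect lB ?S N f x - nij_defect (dual_rep_on_base scale (Rop brd)) ?S N f x" for x f
    by (simp add: nij_defect_def Ns algebra_simps)
  have "nijenhuis_matched_pair scale UNIV br N fscale (dual scale) brd ?S lA rA lB rB \<longleftrightarrow>
    matched_pair scale UNIV br fscale (dual scale) brd lA rA lB rB \<and>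
    (\<forall>x. \<forall>f\<in>dual scale. nij_defect lA N ?S x f = 0) \<and>
    (\<forall>x. \<forall>f\<in>dual scale. nij_defect (dual_rep (Rop br)) N ?S x f = 0) \<and>
    (\<forall>f\<in>dual scale. \<forall>x. nij_defect lB ?S N f x = 0) \<and>
    (\<forall>f\<in>dual scale. \<forall>x. nij_defect (dual_rep_on_base scale (Rop brd)) ?S N f x = 0)"
    unfolding nijenhuis_matched_pair_iff_defect[OF A B] rA rB by auto
  moreover have "(\<forall>f\<in>dual scale. \<forall>x. nij_defect lB ?S N f x = 0) \<longleftrightarrow>
      (\<forall>x. \<forall>f\<in>dual scale. \<forall>g\<in>dual scale. brd (f \<circ> S) g (N x) + brd f (g \<circ> (N \<circ> N)) x =
        brd (f \<circ> S) (g \<circ> N) x + brd f (g \<circ> N) (N x))"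
    using nij_defect_dual_rep_on_base_iff[OF bilinear_ops(3) N S] by (auto simp: Lop_def)
  moreover have "(\<forall>f\<in>dual scale. \<forall>x. nij_defect (dual_rep_on_base scale (Rop brd)) ?S N f x = 0) \<longleftrightarrow>
      (\<forall>x. \<forall>f\<in>dual scale. \<forall>g\<in>dual scale. brd f (g \<circ> S) (N x) + brd (f \<circ> (N \<circ> N)) g x =
        brd (f \<circ> N) (g \<circ> S) x + brd (f \<circ> N) g (N x))"
    using nij_defect_dual_rep_on_base_iff[OF bilinear_ops(4) N S] by (auto simp: Rop_def)
  moreover have "(\<forall>x. \<forall>f\<in>dual scale. nij_defect lA N ?S x f = 0) \<longleftrightarrow>
      (\<forall>x y. S (br (N x) y) + br x (S (S y)) = S (br x (S y)) + br (N x) (S y))"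
    by (simp only: nij_defect_dual_rep_iff[OF S] Lop_def)
  moreover have "(\<forall>x. \<forall>f\<in>dual scale. nij_defect (dual_rep (Rop br)) N ?S x f = 0) \<longleftrightarrow>
      (\<forall>x y. S (br x (N y)) + br (S (S x)) y = S (br (S x) y) + br (S x) (N y))"
    unfolding nij_defect_dual_rep_iff[OF S] Rop_def by blast
  ultimately show ?thesis
    unfolding matched_pair_iff_match_form by argo
qed

end

section \<open>Evaluating tensors on pairs of functionals\<close>

context finite_dimensional_vector_space
begin

text \<open>
  The summands of a Sweedler sum take values in a tensor power, that is in a space of functions, and
  at every point they are a product of one functional of each argument.  This property gives the
  bilinearity that makes the sum independent of the chosen decomposition, and it identifies each value
  of the sum with a value of the original tensor, by \<open>sweedler_apply\<close>.
\<close>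

definition factorizes2 :: "('b \<Rightarrow> 'b \<Rightarrow> 'x \<Rightarrow> 'a) \<Rightarrow> bool" where
  "factorizes2 h \<longleftrightarrow> (\<forall>\<omega>. \<exists>f\<in>dual scale. \<exists>g\<in>dual scale. \<forall>a b. h a b \<omega> = f a * g b)"

lemma factorizes2_bilinear_on:
  assumes "factorizes2 h"
  shows "bilinear_on scale UNIV scale UNIV fscale UNIV h"
proof -
  have "h (a + a') b \<omega> = h a b \<omega> + h a' b \<omega>" "h (c *s a) b \<omega> = c * h a b \<omega>"
    "h a (b + b') \<omega> = h a b \<omega> + h a b' \<omega>" "h a (c *s b) \<omega> = c * h a b \<omega>" for a a' b b' c \<omega>
  proof -
    obtain f g where f: "f \<in> dual scale" and g: "g \<in> dual scale" and h: "\<And>a b. h a b \<omega> = f a * g b"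
      using assms unfolding factorizes2_def by blast
    show "h (a + a') b \<omega> = h a b \<omega> + h a' b \<omega>" "h (c *s a) b \<omega> = c * h a b \<omega>"
      "h a (b + b') \<omega> = h a b \<omega> + h a b' \<omega>" "h a (c *s b) \<omega> = c * h a b \<omega>"
      by (simp_all add: h dual_simps[OF f] dual_simps[OF g] algebra_simps)
  qed
  then show ?thesis
    by (simp add: bilinear_on_def linear_on_def fun_eq_iff fscale_def)
qed

lemma sweedler_apply:
  assumes "t \<in> tensor2 scale" and "factorizes2 h"
    and f: "f \<in> dual scale" and g: "g \<in> dual scale" and h: "\<And>a b. h a b \<omega> = f a * g b"
  shows "sweedler scale t h \<omega> = t (f, g)"
proof -
  obtain ps where t: "t = (\<Sum>(a, b)\<leftarrow>ps. tens2 scale a b)"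
    using assms(1) unfolding tensor2_sum_list by blast
  have "sweedler scale t h = (\<Sum>(a, b)\<leftarrow>ps. h a b)"
    unfolding t by (rule sweedler_sum[OF vector_space_fscale factorizes2_bilinear_on[OF assms(2)]])
  then show ?thesis
    unfolding t by (simp add: sum_list_apply case_prod_unfold h tens2_def f g)
qed

lemma tens2_pairing_eq:
  assumes "t \<in> tensor2 scale" and f: "f \<in> dual scale" and g: "g \<in> dual scale"
  shows "tens2_pairing scale f g t = t (f, g)"
proof -
  obtain ps where t: "t = (\<Sum>(a, b)\<leftarrow>ps. tens2 scale a b)"
    using assms(1) unfolding tensor2_sum_list by blast
  have "vector_space ((*) :: 'a \<Rightarrow> 'a \<Rightarrow> 'a)"
    by unfold_locales (simp_all add: algebra_simps)
  moreover have "bilinear_on scale UNIV scale UNIV (*) UNIV (\<lambda>a b. f a * g b)"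
    by (simp add: bilinear_on_def linear_on_def dual_simps[OF f] dual_simps[OF g] algebra_simps)
  ultimately have "tens2_pairing scale f g t = (\<Sum>(a, b)\<leftarrow>ps. f a * g b)"
    unfolding tens2_pairing_def t by (rule sweedler_sum)
  then show ?thesis
    unfolding t by (simp add: sum_list_apply case_prod_unfold tens2_def f g)
qed

lemma tensor2_off_dual:
  assumes "t \<in> tensor2 scale" and "\<not> (f \<in> dual scale \<and> g \<in> dual scale)"
  shows "t (f, g) = 0"
proof -
  obtain ps where t: "t = (\<Sum>(a, b)\<leftarrow>ps. tens2 scale a b)"
    using assms(1) unfolding tensor2_sum_list by blast
  have "(\<Sum>(a, b)\<leftarrow>ps. tens2 scale a b) (f, g) = 0"
    using assms(2) by (induction ps) (auto simp: tens2_def)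
  then show ?thesis by (simp add: t)
qed

text \<open>
  Tensors vanish off the dual space, so they are determined by their values on pairs of functionals;
  every tensor identity below is proved by comparing these values.
\<close>

lemma tensor2_eq_iff:
  assumes "t \<in> tensor2 scale" and "t' \<in> tensor2 scale"
  shows "t = t' \<longleftrightarrow> (\<forall>f\<in>dual scale. \<forall>g\<in>dual scale. t (f, g) = t' (f, g))"
proof
  assume *: "\<forall>f\<in>dual scale. \<forall>g\<in>dual scale. t (f, g) = t' (f, g)"
  show "t = t'"
  proof
    fix p :: "('b \<Rightarrow> 'a) \<times> ('b \<Rightarrow> 'a)"
    obtain f g where p: "p = (f, g)" by (cases p)
    show "t p = t' p"
      using * tensor2_off_dual[OF assms(1)] tensor2_off_dual[OF assms(2)]
      unfolding p by (cases "f \<in> dual scale \<and> g \<in> dual scale") (simp, metis)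
  qed
qed simp

lemma vec_space_on_tensor2: "vec_space_on fscale (tensor2 scale)"
proof -
  interpret F: vector_space "fscale :: 'a \<Rightarrow> (('b \<Rightarrow> 'a) \<times> ('b \<Rightarrow> 'a) \<Rightarrow> 'a) \<Rightarrow> _"
    by (rule vector_space_fscale)
  show ?thesis
    by (simp add: vec_space_on_def tensor2_def F.vector_space_axioms)
qed

lemma factorizes2_tens2:
  assumes F: "linear_on scale UNIV scale UNIV F" and G: "linear_on scale UNIV scale UNIV G"
  shows "factorizes2 (\<lambda>a b. tens2 scale (F a) (G b))" "factorizes2 (\<lambda>a b. tens2 scale (G b) (F a))"
proof -
  have z: "(\<lambda>x. 0) \<in> dual scale" by (simp add: dual_iff)
  have "\<exists>f\<in>dual scale. \<exists>g\<in>dual scale. \<forall>a b. tens2 scale (F a) (G b) (\<phi>, \<gamma>) = f a * g b" for \<phi> \<gamma>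
  proof (cases "\<phi> \<in> dual scale \<and> \<gamma> \<in> dual scale")
    case True
    then show ?thesis
      by (intro bexI[of _ "\<phi> \<circ> F"] bexI[of _ "\<gamma> \<circ> G"]) (auto simp: tens2_def dual_comp F G)
  next
    case False
    then show ?thesis using z by (intro bexI[of _ "\<lambda>x. 0"]) (auto simp: tens2_def)
  qed
  then show "factorizes2 (\<lambda>a b. tens2 scale (F a) (G b))" unfolding factorizes2_def by auto
  have "\<exists>f\<in>dual scale. \<exists>g\<in>dual scale. \<forall>a b. tens2 scale (G b) (F a) (\<phi>, \<gamma>) = f a * g b" for \<phi> \<gamma>
  proof (cases "\<phi> \<in> dual scale \<and> \<gamma> \<in> dual scale")
    case True
    then show ?thesis
      by (intro bexI[of _ "\<gamma> \<circ> F"] bexI[of _ "\<phi> \<circ> G"]) (auto simp: tens2_def dual_comp F G mult.commute)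
  next
    case False
    then show ?thesis using z by (intro bexI[of _ "\<lambda>x. 0"]) (auto simp: tens2_def)
  qed
  then show "factorizes2 (\<lambda>a b. tens2 scale (G b) (F a))" unfolding factorizes2_def by auto
qed

lemma sweedler_tensor2:
  assumes "t \<in> tensor2 scale" and h: "factorizes2 h" and "\<And>a b. h a b \<in> tensor2 scale"
  shows "sweedler scale t h \<in> tensor2 scale"
proof -
  obtain ps where t: "t = (\<Sum>(a, b)\<leftarrow>ps. tens2 scale a b)"
    using assms(1) unfolding tensor2_sum_list by blast
  have "(\<Sum>(a, b)\<leftarrow>ps. h a b) \<in> tensor2 scale"
    by (induction ps)
      (simp_all only: list.map sum_list.Nil sum_list.Cons case_prod_unfold assms(3)
        vec_space_on_closed[OF vec_space_on_tensor2])
  then show ?thesis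
    unfolding t by (simp only: sweedler_sum[OF vector_space_fscale factorizes2_bilinear_on[OF h]])
qed

lemma tens2_in_tensor2: "tens2 scale a b \<in> tensor2 scale"
proof -
  have "(\<Sum>(a, b)\<leftarrow>[(a, b)]. tens2 scale a b) \<in> tensor2 scale"
    unfolding tensor2_sum_list by blast
  then show ?thesis by simp
qed

lemma linear_on_id: "linear_on scale UNIV scale UNIV id"
  by (simp add: linear_on_def)

lemma map_tens2_tensor:
  assumes "t \<in> tensor2 scale"
    and F: "linear_on scale UNIV scale UNIV F" and G: "linear_on scale UNIV scale UNIV G"
  shows "map_tens2 scale F G t \<in> tensor2 scale"
    and "f \<in> dual scale \<Longrightarrow> g \<in> dual scale \<Longrightarrow> map_tens2 scale F G t (f, g) = t (f \<circ> F, g \<circ> G)"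
  unfolding map_tens2_def
  using sweedler_tensor2[OF assms(1) factorizes2_tens2(1)[OF F G] tens2_in_tensor2]
    sweedler_apply[OF assms(1) factorizes2_tens2(1)[OF F G] dual_comp[OF _ F] dual_comp[OF _ G]]
  by (simp_all add: tens2_def)

lemma flip_tensor:
  assumes "t \<in> tensor2 scale"
  shows "flip scale t \<in> tensor2 scale"
    and "f \<in> dual scale \<Longrightarrow> g \<in> dual scale \<Longrightarrow> flip scale t (f, g) = t (g, f)"
  unfolding flip_def
  using sweedler_tensor2[OF assms factorizes2_tens2(2)[OF linear_on_id linear_on_id] tens2_in_tensor2]
    sweedler_apply[OF assms factorizes2_tens2(2)[OF linear_on_id linear_on_id]]
  by (simp_all add: tens2_def mult.commute)

end

section \<open>The dual comultiplication\<close>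

locale alia_dual_comultiplication = alia_dual_pair +
  fixes \<Delta> :: "'b \<Rightarrow> (('b \<Rightarrow> 'a) \<times> ('b \<Rightarrow> 'a) \<Rightarrow> 'a)"
  assumes linear_Delta: "linear_on scale UNIV fscale (tensor2 scale) \<Delta>"
    and Delta_pairing:
      "\<And>x f g. f \<in> dual scale \<Longrightarrow> g \<in> dual scale \<Longrightarrow> tens2_pairing scale f g (\<Delta> x) = brd f g x"
begin

lemma Delta_tensor2: "\<Delta> x \<in> tensor2 scale"
  using linear_Delta by (simp add: linear_on_def)

lemma Delta_apply: "f \<in> dual scale \<Longrightarrow> g \<in> dual scale \<Longrightarrow> \<Delta> x (f, g) = brd f g x"
  using Delta_pairing tens2_pairing_eq[OF Delta_tensor2] by metis

text \<open>
  Evaluating the inner sum at a point turns the iterated sum into an ordinary one: a product of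
  functionals \<open>f\<close>, \<open>g\<close>, \<open>h\<close> reads \<open>(\<Delta> \<otimes> id) \<circ> \<Delta>\<close> as the iterated product \<open>[[f, g], h]\<close>.
\<close>

lemma sweedler3_apply:
  assumes T: "\<And>\<omega>. \<exists>f\<in>dual scale. \<exists>g\<in>dual scale. \<exists>h\<in>dual scale. \<forall>p q v. T p q v \<omega> = f p * g q * h v"
    and f: "f \<in> dual scale" and g: "g \<in> dual scale" and h: "h \<in> dual scale"
    and eq: "\<And>p q v. T p q v \<omega> = f p * g q * h v"
  shows "sweedler3 scale \<Delta> x T \<omega> = brd (brd f g) h x"
proof -
  let ?H = "\<lambda>u v. sweedler scale (\<Delta> u) (\<lambda>p q. T p q v)"
  have fac: "factorizes2 (\<lambda>p q. T p q v)" for v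
    unfolding factorizes2_def
  proof
    fix \<omega>
    obtain f g h where fgh: "f \<in> dual scale" "g \<in> dual scale" "h \<in> dual scale"
      "\<And>p q v. T p q v \<omega> = f p * g q * h v"
      using T by meson
    then show "\<exists>f\<in>dual scale. \<exists>g\<in>dual scale. \<forall>p q. T p q v \<omega> = f p * g q"
      by (intro bexI[of _ f] bexI[of _ "fscale (h v) g"])
        (auto simp: fscale_def dual_iff algebra_simps)
  qed
  have H: "?H u v \<omega> = brd f g u * h v"
    if fgh: "f \<in> dual scale" "g \<in> dual scale" "h \<in> dual scale" "\<And>p q v. T p q v \<omega> = f p * g q * h v"
    for f g h \<omega> u v
  proof -
    have d: "fscale (h v) g \<in> dual scale" using fgh(2) by (rule dual_closed)
    have "?H u v \<omega> = \<Delta> u (f, fscale (h v) g)"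
      by (rule sweedler_apply[OF Delta_tensor2 fac fgh(1) d]) (simp add: fgh(4) fscale_def)
    also have "\<dots> = brd f g u * h v"
      unfolding Delta_apply[OF fgh(1) d] brd_simps(8)[OF fgh(1,2)] by (simp add: fscale_def)
    finally show ?thesis .
  qed
  have "factorizes2 ?H"
    unfolding factorizes2_def
  proof
    fix \<omega>
    obtain f g h where fgh: "f \<in> dual scale" "g \<in> dual scale" "h \<in> dual scale"
      "\<And>p q v. T p q v \<omega> = f p * g q * h v"
      using T by meson
    show "\<exists>f\<in>dual scale. \<exists>g\<in>dual scale. \<forall>u v. ?H u v \<omega> = f u * g v"
      using H[OF fgh] brd_simps(1)[OF fgh(1,2)] fgh(3) by blast
  qed
  then have "sweedler3 scale \<Delta> x T \<omega> = \<Delta> x (brd f g, h)"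
    unfolding sweedler3_def
    by (rule sweedler_apply[OF Delta_tensor2 _ brd_simps(1)[OF f g] h]) (rule H[OF f g h eq])
  then show ?thesis
    by (simp add: Delta_apply[OF brd_simps(1)[OF f g] h])
qed

text \<open>
  The six terms of the coalgebra identity differ by a permutation \<open>\<pi>\<close> of the tensor factors, which
  becomes a permutation of the functionals.  At a point outside the dual spaces the summands vanish, so
  they are products of zero functionals there.
\<close>

lemma sweedler3_perm:
  assumes perm: "\<And>p q v f g h. T p q v (f, g, h) =
      (if f \<in> dual scale \<and> g \<in> dual scale \<and> h \<in> dual scale
       then fst (\<pi> (f, g, h)) p * fst (snd (\<pi> (f, g, h))) q * snd (snd (\<pi> (f, g, h))) v else 0)"
    and \<pi>: "\<And>f g h. f \<in> dual scale \<Longrightarrow> g \<in> dual scale \<Longrightarrow> h \<in> dual scale \<Longrightarrow>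
      \<pi> (f, g, h) \<in> dual scale \<times> dual scale \<times> dual scale"
  shows "sweedler3 scale \<Delta> x T (f, g, h) =
      (if f \<in> dual scale \<and> g \<in> dual scale \<and> h \<in> dual scale
       then (case \<pi> (f, g, h) of (f', g', h') \<Rightarrow> brd (brd f' g') h' x) else 0)"
proof -
  have z: "(\<lambda>x. 0) \<in> dual scale" by (simp add: dual_iff)
  have T: "\<exists>f\<in>dual scale. \<exists>g\<in>dual scale. \<exists>h\<in>dual scale. \<forall>p q v. T p q v \<omega> = f p * g q * h v" for \<omega>
  proof -
    obtain f g h where w: "\<omega> = (f, g, h)" by (cases \<omega>)
    show ?thesis
    proof (cases "f \<in> dual scale \<and> g \<in> dual scale \<and> h \<in> dual scale")
      case True
      then show ?thesis
        using \<pi>[of f g h] unfolding w perm by (auto simp: mem_Times_iff)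
    next
      case False
      then show ?thesis unfolding w perm by (intro bexI[OF _ z]) auto
    qed
  qed
  show ?thesis
  proof (cases "f \<in> dual scale \<and> g \<in> dual scale \<and> h \<in> dual scale")
    case True
    then have "\<pi> (f, g, h) \<in> dual scale \<times> dual scale \<times> dual scale" using \<pi> by blast
    then have "sweedler3 scale \<Delta> x T (f, g, h) =
        brd (brd (fst (\<pi> (f, g, h))) (fst (snd (\<pi> (f, g, h))))) (snd (snd (\<pi> (f, g, h)))) x"
      using True by (intro sweedler3_apply[OF T]) (auto simp: mem_Times_iff perm)
    then show ?thesis using True by (simp add: case_prod_unfold)
  next
    case False
    have "sweedler3 scale \<Delta> x T (f, g, h) = brd (brd (\<lambda>x. 0) (\<lambda>x. 0)) (\<lambda>x. 0) x"
      using False z by (intro sweedler3_apply[OF T]) (auto simp: perm)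
    also have "\<dots> = 0"
      using brd_simps(9)[of "brd 0 0"] brd_simps(1)[of 0 0] dual_closed(1) by (simp add: zero_fun_def)
    finally show ?thesis using False by auto
  qed
qed

text \<open>
  At functionals \<open>f\<close>, \<open>g\<close>, \<open>h\<close> the two sides are the two sides of the left Alia identity on the dual.
\<close>

lemma left_alia_coalgebra_Delta: "left_alia_coalgebra scale \<Delta>"
  unfolding left_alia_coalgebra_def
proof (intro conjI allI vector_space_axioms linear_Delta ext)
  fix x and \<omega> :: "('b \<Rightarrow> 'a) \<times> ('b \<Rightarrow> 'a) \<times> ('b \<Rightarrow> 'a)"
  obtain f g h where w: "\<omega> = (f, g, h)" by (cases \<omega>)
  have T1: "sweedler3 scale \<Delta> x (\<lambda>p q v. tens3 scale q p v) (f, g, h) =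
      (if f \<in> dual scale \<and> g \<in> dual scale \<and> h \<in> dual scale then brd (brd g f) h x else 0)"
    by (subst sweedler3_perm[where \<pi> = "\<lambda>(f, g, h). (g, f, h)"]; simp add: tens3_def mult_ac)
  have T2: "sweedler3 scale \<Delta> x (\<lambda>p q v. tens3 scale p v q) (f, g, h) =
      (if f \<in> dual scale \<and> g \<in> dual scale \<and> h \<in> dual scale then brd (brd f h) g x else 0)"
    by (subst sweedler3_perm[where \<pi> = "\<lambda>(f, g, h). (f, h, g)"]; simp add: tens3_def mult_ac)
  have T3: "sweedler3 scale \<Delta> x (\<lambda>p q v. tens3 scale v q p) (f, g, h) =
      (if f \<in> dual scale \<and> g \<in> dual scale \<and> h \<in> dual scale then brd (brd h g) f x else 0)"
    by (subst sweedler3_perm[where \<pi> = "\<lambda>(f, g, h). (h, g, f)"]; simp add: tens3_def mult_ac)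
  have T4: "sweedler3 scale \<Delta> x (\<lambda>p q v. tens3 scale p q v) (f, g, h) =
      (if f \<in> dual scale \<and> g \<in> dual scale \<and> h \<in> dual scale then brd (brd f g) h x else 0)"
    by (subst sweedler3_perm[where \<pi> = "\<lambda>(f, g, h). (f, g, h)"]; simp add: tens3_def mult_ac)
  have T5: "sweedler3 scale \<Delta> x (\<lambda>p q v. tens3 scale q v p) (f, g, h) =
      (if f \<in> dual scale \<and> g \<in> dual scale \<and> h \<in> dual scale then brd (brd h f) g x else 0)"
    by (subst sweedler3_perm[where \<pi> = "\<lambda>(f, g, h). (h, f, g)"]; simp add: tens3_def mult_ac)
  have T6: "sweedler3 scale \<Delta> x (\<lambda>p q v. tens3 scale v p q) (f, g, h) =
      (if f \<in> dual scale \<and> g \<in> dual scale \<and> h \<in> dual scale then brd (brd g h) f x else 0)"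
    by (subst sweedler3_perm[where \<pi> = "\<lambda>(f, g, h). (g, h, f)"]; simp add: tens3_def mult_ac)
  have "brd (brd f g) h x + brd (brd g h) f x + brd (brd h f) g x =
      brd (brd g f) h x + brd (brd h g) f x + brd (brd f h) g x"
    if "f \<in> dual scale" "g \<in> dual scale" "h \<in> dual scale"
  proof -
    have "brd (brd f g) h + brd (brd g h) f + brd (brd h f) g =
        brd (brd g f) h + brd (brd h g) f + brd (brd f h) g"
      using alia_dual that unfolding left_alia_def by blast
    from fun_cong[OF this, of x] show ?thesis by simp
  qed
  then show "(sweedler3 scale \<Delta> x (\<lambda>p q v. tens3 scale q p v)
          + sweedler3 scale \<Delta> x (\<lambda>p q v. tens3 scale p v q)
          + sweedler3 scale \<Delta> x (\<lambda>p q v. tens3 scale v q p)) \<omega>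
        = (sweedler3 scale \<Delta> x (\<lambda>p q v. tens3 scale p q v)
          + sweedler3 scale \<Delta> x (\<lambda>p q v. tens3 scale q v p)
          + sweedler3 scale \<Delta> x (\<lambda>p q v. tens3 scale v p q)) \<omega>"
    unfolding w plus_fun_apply T1 T2 T3 T4 T5 T6 by (auto simp: algebra_simps)
qed

lemma linear_Rop: "linear_on scale UNIV scale UNIV (Rop br y)"
  by (simp add: linear_on_def Rop_def br_simps)

text \<open>
  At a pair \<open>(f, g)\<close> the operator \<open>\<R>(y) \<otimes> id\<close> replaces \<open>f\<close> by \<open>f \<circ> \<R>(y)\<close>, and \<open>\<tau> - id\<close>
  antisymmetrizes in \<open>f\<close> and \<open>g\<close>; the difference of the two sides is then \<open>match_form\<close>.
\<close>

lemma compatibility_iff: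
  "(let t = \<Delta> (br x y - br y x);
        t' = map_tens2 scale (Rop br y) id (\<Delta> x) - map_tens2 scale (Rop br x) id (\<Delta> y)
    in flip scale t - t = flip scale t' - t') \<longleftrightarrow>
   (\<forall>f\<in>dual scale. \<forall>g\<in>dual scale. match_form x y f g = 0)"
proof -
  let ?t' = "map_tens2 scale (Rop br y) id (\<Delta> x) - map_tens2 scale (Rop br x) id (\<Delta> y)"
  note T = vec_space_on_closed[OF vec_space_on_tensor2]
  note M = map_tens2_tensor[OF Delta_tensor2 linear_Rop linear_on_id]
  have t': "?t' \<in> tensor2 scale" by (intro T(3) M(1))
  have m: "map_tens2 scale (Rop br w) id (\<Delta> z) (f, g) = brd (\<lambda>v. f (br v w)) g z"
    if "f \<in> dual scale" "g \<in> dual scale" for f g w z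
    using M(2)[OF that] Delta_apply[OF dual_br[OF that(1)] that(2)] by (simp add: comp_def Rop_def)
  have "(flip scale (\<Delta> (br x y - br y x)) - \<Delta> (br x y - br y x)) (f, g) = (flip scale ?t' - ?t') (f, g)
      \<longleftrightarrow> match_form x y f g = 0" if "f \<in> dual scale" "g \<in> dual scale" for f g
  proof -
    have "(flip scale (\<Delta> (br x y - br y x)) - \<Delta> (br x y - br y x)) (f, g) =
        (brd g f - brd f g) (br x y - br y x)"
      using that by (simp add: flip_tensor(2)[OF Delta_tensor2] Delta_apply)
    moreover have "(flip scale ?t' - ?t') (f, g) =
        brd (\<lambda>v. g (br v y)) f x - brd (\<lambda>v. f (br v y)) g x
        - brd (\<lambda>v. g (br v x)) f y + brd (\<lambda>v. f (br v x)) g y"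
      using that by (simp add: flip_tensor(2)[OF t'] m)
    ultimately show ?thesis
      by (simp only: match_form_def right_minus_eq)
  qed
  then show ?thesis
    unfolding Let_def
      tensor2_eq_iff[OF T(3)[OF flip_tensor(1)[OF Delta_tensor2] Delta_tensor2] T(3)[OF flip_tensor(1)[OF t'] t']]
    by blast
qed

text \<open>
  Both sides reduce to the vanishing of \<open>match_form\<close> together with the same four scalar identities.
  What a Nijenhuis left Alia bialgebra requires beyond these, the coalgebra identity and the identity
  between \<open>S\<close> and \<open>\<Delta>\<close>, is the dual form of the structure given on \<open>A\<^sup>*\<close>.
\<close>

theorem bialgebra_iff:
  assumes A: "nijenhuis_left_alia scale UNIV br N" and S: "linear_on scale UNIV scale UNIV S"
    and B: "nijenhuis_left_alia fscale (dual scale) brd (transpose_map S)"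
  shows "nijenhuis_left_alia_bialgebra scale br \<Delta> N S \<longleftrightarrow>
    nijenhuis_matched_pair scale UNIV br N fscale (dual scale) brd (transpose_map S) lA rA lB rB"
proof -
  have N: "linear_on scale UNIV scale UNIV N" using A by (simp add: nijenhuis_left_alia_def)
  have NN: "linear_on scale UNIV scale UNIV (N \<circ> N)"
    using N by (simp add: linear_on_def)
  note T = vec_space_on_closed(2)[OF vec_space_on_tensor2]
  note M = map_tens2_tensor[OF Delta_tensor2]
  note lin = N S NN linear_on_id
  have coalg_S: "map_tens2 scale S S (\<Delta> x) + \<Delta> (S (S x))
          = map_tens2 scale S id (\<Delta> (S x)) + map_tens2 scale id S (\<Delta> (S x))" for x
  proof -
    have "brd (f \<circ> S) (g \<circ> S) x + brd f g (S (S x)) = brd (f \<circ> S) g (S x) + brd f (g \<circ> S) (S x)"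
      if "f \<in> dual scale" "g \<in> dual scale" for f g
    proof -
      have "brd (f \<circ> S) (g \<circ> S) + (brd f g \<circ> S \<circ> S) = (brd (f \<circ> S) g + brd f (g \<circ> S)) \<circ> S"
        using B that unfolding nijenhuis_left_alia_def transpose_map_def by blast
      from fun_cong[OF this, of x] show ?thesis by simp
    qed
    then show ?thesis
      by (subst tensor2_eq_iff) (simp_all add: T M lin Delta_tensor2 Delta_apply dual_comp)
  qed
  have S4: "map_tens2 scale S id (\<Delta> (N x)) + map_tens2 scale id (N \<circ> N) (\<Delta> x)
          = map_tens2 scale S N (\<Delta> x) + map_tens2 scale id N (\<Delta> (N x)) \<longleftrightarrow>
      (\<forall>f\<in>dual scale. \<forall>g\<in>dual scale.
      brd (f \<circ> S) g (N x) + brd f (g \<circ> (N \<circ> N)) x = brd (f \<circ> S) (g \<circ> N) x + brd f (g \<circ> N) (N x))" for x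
    by (subst tensor2_eq_iff) (simp_all add: T M lin Delta_apply dual_comp)
  have S5: "map_tens2 scale id S (\<Delta> (N x)) + map_tens2 scale (N \<circ> N) id (\<Delta> x)
          = map_tens2 scale N S (\<Delta> x) + map_tens2 scale N id (\<Delta> (N x)) \<longleftrightarrow>
      (\<forall>f\<in>dual scale. \<forall>g\<in>dual scale.
      brd f (g \<circ> S) (N x) + brd (f \<circ> (N \<circ> N)) g x = brd (f \<circ> N) (g \<circ> S) x + brd (f \<circ> N) g (N x))" for x
    by (subst tensor2_eq_iff) (simp_all add: T M lin Delta_apply dual_comp)
  show ?thesis
    unfolding nijenhuis_matched_pair_iff[OF A S B] nijenhuis_left_alia_bialgebra_def
      left_alia_bialgebra_def compatibility_iff S4 S5
    using A S alia left_alia_coalgebra_Delta coalg_S by simp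
qed

end

section \<open>The equivalence\<close>

theorem theorem2p24:
  fixes scale :: "'k::field_char_0 \<Rightarrow> 'a::ab_group_add \<Rightarrow> 'a"
    and Basis :: "'a set"
    and br :: "'a \<Rightarrow> 'a \<Rightarrow> 'a"
    and N S :: "'a \<Rightarrow> 'a"
    and brd :: "('a \<Rightarrow> 'k) \<Rightarrow> ('a \<Rightarrow> 'k) \<Rightarrow> ('a \<Rightarrow> 'k)"
    and \<Delta> :: "'a \<Rightarrow> (('a \<Rightarrow> 'k) \<times> ('a \<Rightarrow> 'k) \<Rightarrow> 'k)"
  assumes fin_dim: "finite_dimensional_vector_space scale Basis"
    and A: "nijenhuis_left_alia scale UNIV br N"
    and S: "linear_on scale UNIV scale UNIV S"
    and A_dual: "nijenhuis_left_alia fscale (dual scale) brd (transpose_map S)"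
    and Delta: "linear_on scale UNIV fscale (tensor2 scale) \<Delta>"
    and Delta_dual: "\<forall>x. \<forall>f\<in>dual scale. \<forall>g\<in>dual scale. tens2_pairing scale f g (\<Delta> x) = brd f g x"
  shows "(nijenhuis_matched_pair scale UNIV br N fscale (dual scale) brd (transpose_map S)
            (dual_rep (Lop br))
            (\<lambda>x f. dual_rep (Lop br) x f - dual_rep (Rop br) x f)
            (dual_rep_on_base scale (Lop brd))
            (\<lambda>f x. dual_rep_on_base scale (Lop brd) f x - dual_rep_on_base scale (Rop brd) f x)
          \<longleftrightarrow> (\<exists>BR. nijenhuis_manin_triple scale br N brd (transpose_map S) BR))
       \<and> ((\<exists>BR. nijenhuis_manin_triple scale br N brd (transpose_map S) BR)
          \<longleftrightarrow> nijenhuis_left_alia_bialgebra scale br \<Delta> N S)"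
proof -
  interpret finite_dimensional_vector_space scale Basis by (rule fin_dim)
  interpret alia_dual_comultiplication scale Basis br brd \<Delta>
    using A A_dual Delta Delta_dual
    by unfold_locales (simp_all add: nijenhuis_left_alia_def)
  show ?thesis
    unfolding manin_triple_iff[OF A A_dual] bialgebra_iff[OF A S A_dual] by simp
qed

end
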